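(* Let $n\ge 4$ and let $\alpha,\beta$ be orderings (permutations) of $\{1,\dots,n\}$ with $\alpha(n)=\beta(n)=n$. For the dual associahedra $\mathcal{A}(\alpha)^*$ and $\mathcal{A}(\beta)^*$, with boundaries $\partial\mathcal{A}(\alpha)^*,\partial\mathcal{A}(\beta)^*$ canonically embedded in $\mathcal{K}_n^*$, the biadjoint scalar tree amplitude is given by $$m(\alpha|\beta)= I_{\mathrm{Cone}\left(\partial\mathcal{A}(\alpha)^*\cap\partial\mathcal{A}(\beta)^*\right)}(Z,1),$$ where both sides are functions of $Z=(s_{ij})\in\mathcal{K}_n$, with $Z$ such that $W\cdot Z>0$ for all nonzero $W$ in the cone, so that the integral $I$ is well defined.
   Context: **Kinematic space.** $\mathcal{V}_n=\mathbb{R}^{(n-1)(n-2)/2}$ has coordinates $s_{ij}=s_{ji}$ for $1\le i<j\le n-1$ (and $s_{ii}=0$). $\mathcal{K}_n\subset\mathcal{V}_n$ is the hyperplane $\sum_{1\le i<j\le n-1}s_{ij}=0$, of dimension $n(n-3)/2$. $\mathcal{K}_n^*$ is its dual vector space, with pairing $W\cdot Z$. **Covectors $W_S$.** For $S\subset\{1,\dots,n-1\}$ with $2\le|S|\le n-2$, put $s_S=\sum_{i<j,\ i,j\in S}s_{ij}$. Define $W_S\in\mathcal{K}_n^*$ by $W_S\cdot Z=-\tfrac12\sum_{i,j\in S}s_{ij}=-s_S$. **Associahedra.** A set $S$ is $\alpha$-consecutive if $S=\{\alpha(a),\alpha(a+1),\dots,\alpha(a+k)\}$ for some positive integers $a,k$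 with $a+k\le n-1$; only such $S$ with $2\le|S|\le n-2$ are used below. Let $\mathcal{C}(\alpha)=\{Z\in\mathcal{K}_n: W_S\cdot Z\ge 0 \text{ for all } \alpha\text{-consecutive } S\}$. Let $H(\alpha)\subset\mathcal{K}_n$ be the $(n-3)$-dimensional plane obtained by setting $s_{\alpha(i)\alpha(j)}$ equal to a constant for every pair of non-adjacent $i,j$ less than $n$. The constants are taken generic, so that $\mathcal{A}(\alpha)=\mathcal{C}(\alpha)\cap H(\alpha)$ is a realisation of the $(n-3)$-dimensional associahedron, with facets $\mathcal{A}(\alpha)\cap\{W_S\cdot Z=0\}$, one for each $\alpha$-consecutive $S$. **Canonical embedding.** The dual polytope $\mathcal{A}(\alpha)^*=\{Y\in H(\alpha)^*: Y\cdot Z\ge -1\text{ for all }Z\in\mathcal{A}(\alpha)\}$ (with $H(\alpha)$ regarded as a vector space, compactified projectively where necessary) has a vertex $Y_S$ for each facet $W_S\cdot Z=0$ of $\mathcal{A}(\alpha)$, and a facet for each vertex of $\mathcal{A}(\alpha)$. The canonical embedding sends $Y_S\mapsto W_S$ and sends each (proper) face $\mathrm{Conv}(Y_{S_1},\dots,Y_{S_k})$ of $\mathcal{A}(\alpha)^*$ to $\mathrm{Conv}(W_{S_1},\dots,W_{S_k})\subset\mathcal{K}_n^*$, where $\mathrm{Conv}$ denotes convex hull. The union of these embedded faces is again denoted $\partial\mathcal{A}(\alpha)^*\subset\mathcal{K}_n^*$. Each embedded facet $F$ is the convex hull of $n-3$ covectors $W_{F(1)},\dots,W_{F(n-3)}$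 of the form $W_S$. **Cones and the integral.** For a polytope or union of polytopes $P\subset\mathcal{K}_n^*$, $\mathrm{Cone}(P)=\{\lambda W:\lambda\ge0,\ W\in P\}$, so that $\mathrm{Cone}(P\cup Q)=\mathrm{Cone}(P)\cup\mathrm{Cone}(Q)$. For a polyhedron, or union of polyhedra, $P\subset\mathcal{K}_n^*$, $$I_P(Z,\alpha')=\int_P e^{-\alpha' W\cdot Z}\,dW_P ,$$ where $dW_P$ is the Euclidean volume form of the appropriate dimension to be integrated over $P$ (the $d$-dimensional Euclidean volume if the interior of $P$ has dimension $d$). The volume is such that, for every embedded facet $F$, the box $\{\sum_i c_iW_{F(i)}:0\le c_i<1\}$ has volume $1$. The integral over the empty set is $0$. The parameter $\alpha'$ (unrelated to the ordering $\alpha$) equals $1$ in the claim. **Amplitude.** A trivalent graph here is a tree with $n$ leaves labelled $1,\dots,n$ in which every internal vertex has degree $3$; it has $n-3$ internal edges. It is $\alpha$-planar if it can be drawn in a disc with its leaves on the boundary circle in the cyclic order $\alpha(1),\dots,\alpha(n)$. Each internal edge $e$ determines the set $S_e\subset\{1,\dots,n-1\}$ of leaf labels on the side of $e$ not containing leaf $n$. The amplitude is $$m(\alpha|\beta)=\sum_{g}\ \prod_{e}\frac{1}{-s_{S_e}},$$ where $g$ runs over the trivalent graphs that are both $\alpha$-planar and $\beta$-planar, and $e$ over the internal edges of $g$. An empty sum is $0$.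
   Formalization: The volume is always (n-3)-dimensional, so a lower-dimensional cone has integral 0 (with its own dimension the claim fails: n=6, α=123456, β=351246 gives m=0 but a ray as cone); the constants in H are taken positive and the origin of H lies inside the associahedron. *)

theory Defs
  imports "HOL-Analysis.Analysis" "HOL-Library.Function_Algebras" "HOL-Library.Uprod"
begin

text \<open>
  The dimension of kinematic space varies with \<open>n\<close>, so points and covectors are functions on
  explicit carriers, with the pointwise vector space structure on function types.
\<close>

instantiation "fun" :: (type, real_vector) real_vector
begin

definition scaleR_fun :: "real \<Rightarrow> ('a \<Rightarrow> 'b) \<Rightarrow> 'a \<Rightarrow> 'b"
  where "scaleR_fun r f = (\<lambda>x. r *\<^sub>R f x)"

instance
  by standard
    (auto simp: scaleR_fun_def plus_fun_def scaleR_add_right scaleR_add_left)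

end

type_synonym kin = "nat \<Rightarrow> nat \<Rightarrow> real"

definition mandelstam :: "nat set \<Rightarrow> kin \<Rightarrow> real"
  where "mandelstam S s = (\<Sum>(i, j) \<in> {(i, j). i \<in> S \<and> j \<in> S \<and> i < j}. s i j)"

definition kin_V :: "nat \<Rightarrow> kin set"
  where "kin_V n = {s. (\<forall>i j. s i j = s j i) \<and> (\<forall>i. s i i = 0)
                     \<and> (\<forall>i j. i \<notin> {1..n-1} \<longrightarrow> s i j = 0)}"

definition kin_K :: "nat \<Rightarrow> kin set"
  where "kin_K n = {s \<in> kin_V n. mandelstam {1..n-1} s = 0}"

text \<open>
  A linear functional on a subspace \<open>U\<close> is represented by its extension by \<open>0\<close> outside \<open>U\<close>, so
  that equality of representatives is equality of functionals on \<open>U\<close>.  The pairing of \<open>Y\<close>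
  with \<open>Z\<close> is the application \<open>Y Z\<close>.
\<close>

definition dual_space :: "'v::real_vector set \<Rightarrow> ('v \<Rightarrow> real) set"
  where "dual_space U = {Y. (\<forall>Z. Z \<notin> U \<longrightarrow> Y Z = 0)
                          \<and> (\<forall>Z\<in>U. \<forall>Z'\<in>U. Y (Z + Z') = Y Z + Y Z')
                          \<and> (\<forall>r. \<forall>Z\<in>U. Y (r *\<^sub>R Z) = r * Y Z)}"

definition covector :: "nat \<Rightarrow> nat set \<Rightarrow> kin \<Rightarrow> real"
  where "covector n S = (\<lambda>Z. if Z \<in> kin_K n then - (1/2) * (\<Sum>i\<in>S. \<Sum>j\<in>S. Z i j) else 0)"

definition is_ordering :: "nat \<Rightarrow> (nat \<Rightarrow> nat) \<Rightarrow> bool"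
  where "is_ordering n \<alpha> \<longleftrightarrow> bij_betw \<alpha> {1..n} {1..n} \<and> \<alpha> n = n"

definition consecutive :: "nat \<Rightarrow> (nat \<Rightarrow> nat) \<Rightarrow> nat set set"
  where "consecutive n \<alpha> = {S. (\<exists>a k. 0 < a \<and> 0 < k \<and> a + k \<le> n - 1 \<and> S = \<alpha> ` {a..a+k})
                              \<and> 2 \<le> card S \<and> card S \<le> n - 2}"

definition assoc_C :: "nat \<Rightarrow> (nat \<Rightarrow> nat) \<Rightarrow> kin set"
  where "assoc_C n \<alpha> = {Z \<in> kin_K n. \<forall>S \<in> consecutive n \<alpha>. covector n S Z \<ge> 0}"

definition assoc_H :: "nat \<Rightarrow> (nat \<Rightarrow> nat) \<Rightarrow> (nat \<Rightarrow> nat \<Rightarrow> real) \<Rightarrow> kin set"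
  where "assoc_H n \<alpha> c =
    {Z \<in> kin_K n. \<forall>i j. 1 \<le> i \<and> i + 1 < j \<and> j < n \<longrightarrow> Z (\<alpha> i) (\<alpha> j) = c i j}"

definition associahedron :: "nat \<Rightarrow> (nat \<Rightarrow> nat) \<Rightarrow> (nat \<Rightarrow> nat \<Rightarrow> real) \<Rightarrow> kin set"
  where "associahedron n \<alpha> c = assoc_C n \<alpha> \<inter> assoc_H n \<alpha> c"

text \<open>
  The sign of the constants matters: for arbitrary nonzero constants the polytope can be empty or
  have another combinatorial type.  It is the \<open>(n-3)\<close>-dimensional associahedron, with
  one facet for each consecutive set, exactly when all constants are positive.  For
  \<open>j = i + 1\<close> and on other indices the values of \<open>c\<close> are irrelevant.
\<close>

definition assoc_constants :: "nat \<Rightarrow> (nat \<Rightarrow> nat \<Rightarrow> real) \<Rightarrow> bool"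
  where "assoc_constants n c \<longleftrightarrow> (\<forall>i j. 1 \<le> i \<and> i + 1 < j \<and> j < n \<longrightarrow> c i j > 0)"

text \<open>
  To regard the affine plane \<open>assoc_H n \<alpha> c\<close> as a vector space one chooses an origin in it.  With
  the origin in the interior of the associahedron the dual polytope is bounded and needs no
  projective compactification.
\<close>

definition assoc_interior :: "nat \<Rightarrow> (nat \<Rightarrow> nat) \<Rightarrow> (nat \<Rightarrow> nat \<Rightarrow> real) \<Rightarrow> kin set"
  where "assoc_interior n \<alpha> c =
    {Z \<in> assoc_H n \<alpha> c. \<forall>S \<in> consecutive n \<alpha>. covector n S Z > 0}"

abbreviation assoc_dir :: "nat \<Rightarrow> (nat \<Rightarrow> nat) \<Rightarrow> kin set"
  where "assoc_dir n \<alpha> \<equiv> assoc_H n \<alpha> (\<lambda>_ _. 0)"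

text \<open>
  With origin \<open>p\<close>, the plane is identified with its space of directions by \<open>Z \<mapsto> Z - p\<close>.
\<close>

definition dual_assoc :: "nat \<Rightarrow> (nat \<Rightarrow> nat) \<Rightarrow> (nat \<Rightarrow> nat \<Rightarrow> real) \<Rightarrow> kin \<Rightarrow> (kin \<Rightarrow> real) set"
  where "dual_assoc n \<alpha> c p =
    {Y \<in> dual_space (assoc_dir n \<alpha>). \<forall>Z \<in> associahedron n \<alpha> c. Y (Z - p) \<ge> -1}"

text \<open>
  The vertex dual to the facet of \<open>S\<close>: for \<open>Z\<close> in the plane, \<open>Y\<^sub>S (Z - p) = -1\<close> if and only if
  \<open>W\<^sub>S Z = 0\<close>.
\<close>

definition dual_vertex :: "nat \<Rightarrow> (nat \<Rightarrow> nat) \<Rightarrow> kin \<Rightarrow> nat set \<Rightarrow> kin \<Rightarrow> real"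
  where "dual_vertex n \<alpha> p S =
    (\<lambda>Z. if Z \<in> assoc_dir n \<alpha> then covector n S Z / covector n S p else 0)"

text \<open>Faces and facets are given by the labels \<open>S\<close> of their vertices.\<close>

definition dual_faces ::
    "nat \<Rightarrow> (nat \<Rightarrow> nat) \<Rightarrow> (nat \<Rightarrow> nat \<Rightarrow> real) \<Rightarrow> kin \<Rightarrow> nat set set set"
  where "dual_faces n \<alpha> c p =
    {F. F \<subseteq> consecutive n \<alpha>
      \<and> (convex hull (dual_vertex n \<alpha> p ` F)) face_of (dual_assoc n \<alpha> c p)
      \<and> convex hull (dual_vertex n \<alpha> p ` F) \<noteq> dual_assoc n \<alpha> c p}"

definition dual_facets ::
    "nat \<Rightarrow> (nat \<Rightarrow> nat) \<Rightarrow> (nat \<Rightarrow> nat \<Rightarrow> real) \<Rightarrow> kin \<Rightarrow> nat set set set"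
  where "dual_facets n \<alpha> c p =
    {F \<in> dual_faces n \<alpha> c p. \<forall>G \<in> dual_faces n \<alpha> c p. F \<subseteq> G \<longrightarrow> G = F}"

definition dual_boundary ::
    "nat \<Rightarrow> (nat \<Rightarrow> nat) \<Rightarrow> (nat \<Rightarrow> nat \<Rightarrow> real) \<Rightarrow> kin \<Rightarrow> (kin \<Rightarrow> real) set"
  where "dual_boundary n \<alpha> c p = (\<Union>F \<in> dual_faces n \<alpha> c p. convex hull (covector n ` F))"

text \<open>
  The \<open>(n-3)\<close>-dimensional volume on the span of the covectors of a facet \<open>F\<close>, normalised so that
  the box on these covectors has volume 1, is Lebesgue measure in the coordinates
  \<open>(x\<^sub>S)\<close>, \<open>S \<in> F\<close>, of \<open>W = (\<Sum>S\<in>F. x\<^sub>S W\<^sub>S)\<close>.  Different facets span different subspaces, which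
  meet in null sets, so the integral over a subset \<open>P\<close> of the union of these spans is the sum of
  the integrals over the intersections of \<open>P\<close> with each of them.  The volume is always
  \<open>(n-3)\<close>-dimensional; a set \<open>P\<close> of smaller dimension has integral 0.
\<close>

definition facet_point :: "nat \<Rightarrow> nat set set \<Rightarrow> (nat set \<Rightarrow> real) \<Rightarrow> kin \<Rightarrow> real"
  where "facet_point n F x = (\<Sum>S\<in>F. x S *\<^sub>R covector n S)"

definition vol_integral ::
    "nat \<Rightarrow> nat set set set \<Rightarrow> (kin \<Rightarrow> real) set \<Rightarrow> kin \<Rightarrow> real \<Rightarrow> real"
  where "vol_integral n \<F> P Z a =
    (\<Sum>F\<in>\<F>. LINT x | Pi\<^sub>M F (\<lambda>_. lborel).
        indicator P (facet_point n F x) * exp (- a * facet_point n F x Z))"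

text \<open>
  A trivalent graph is rooted at its leaf \<open>n\<close>, which is not written.  Every internal vertex then
  has one edge towards leaf \<open>n\<close> and an unordered pair of branches away from it.  Since the pair is
  unordered, equality of terms is isomorphism of labelled graphs.
\<close>

datatype (leaf_labels: 'a) trivalent = Leaf 'a | Vertex "'a trivalent uprod"

inductive labelled_by :: "'a set \<Rightarrow> 'a trivalent \<Rightarrow> bool"
  where
    "labelled_by {i} (Leaf i)"
  | "labelled_by A l \<Longrightarrow> labelled_by B r \<Longrightarrow> A \<inter> B = {} \<Longrightarrow>
       labelled_by (A \<union> B) (Vertex (Upair l r))"

text \<open>
  A drawing in the disc amounts to a choice, at each internal vertex, of which branch comes
  first on going round the boundary from leaf \<open>n\<close>; \<open>drawn_with g xs\<close> says that some such choice
  lists the other leaves in the order \<open>xs\<close>.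
\<close>

inductive drawn_with :: "'a trivalent \<Rightarrow> 'a list \<Rightarrow> bool"
  where
    "drawn_with (Leaf i) [i]"
  | "drawn_with l xs \<Longrightarrow> drawn_with r ys \<Longrightarrow> drawn_with (Vertex (Upair l r)) (xs @ ys)"

definition trivalent_graphs :: "nat \<Rightarrow> nat trivalent set"
  where "trivalent_graphs n = {g. labelled_by {1..n-1} g}"

definition planar :: "nat \<Rightarrow> (nat \<Rightarrow> nat) \<Rightarrow> nat trivalent \<Rightarrow> bool"
  where "planar n \<alpha> g \<longleftrightarrow> drawn_with g (map \<alpha> [1..<n])"

inductive branch_of :: "'a trivalent \<Rightarrow> 'a trivalent \<Rightarrow> bool"
  where
    "t \<in> set_uprod p \<Longrightarrow> branch_of t (Vertex p)"
  | "branch_of t u \<Longrightarrow> u \<in> set_uprod p \<Longrightarrow> branch_of t (Vertex p)"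

text \<open>
  An internal edge \<open>e\<close> joins two internal vertices.  It is represented by the branch \<open>t\<close> at its
  end away from leaf \<open>n\<close>, and \<open>S\<^sub>e\<close> is then \<open>leaf_labels t\<close>.
\<close>

definition internal_edges :: "'a trivalent \<Rightarrow> 'a trivalent set"
  where "internal_edges g = {t. branch_of t g \<and> (\<exists>p. t = Vertex p)}"

definition amplitude :: "nat \<Rightarrow> (nat \<Rightarrow> nat) \<Rightarrow> (nat \<Rightarrow> nat) \<Rightarrow> kin \<Rightarrow> real"
  where "amplitude n \<alpha> \<beta> Z =
    (\<Sum>g \<in> {g \<in> trivalent_graphs n. planar n \<alpha> g \<and> planar n \<beta> g}.
       \<Prod>t \<in> internal_edges g. 1 / (- mandelstam (leaf_labels t) Z))"

end

theory Submission
  imports Defs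
begin

text \<open>
  The faces of the dual associahedron are the laminar families of consecutive sets, and its facets
  are the families of clades of planar trivalent trees: two crossing sets cannot share a face,
  because the segment between their dual vertices meets a segment that ends at the origin, and every
  planar tree is the label of a vertex of the associahedron whose coordinates can be written down
  by recursion over the tree.

  The cones over two facets, for the same or for different orderings, meet only in common faces.
  For one ordering this holds because the consecutive sets give linearly independent covectors.  For
  two orderings one regards a nonnegative combination of covectors \<open>W\<^sub>S\<close> over a laminar
  family as an ultrametric on the leaves, which is determined up to an additive constant by its
  action on \<open>\<K>\<^sub>n\<close> and from which the family can be recovered.  So up to null sets the cone
  consists of the orthants spanned by the facets common to both orderings, that is by the trees
  planar for both, and the integral of the exponential over an orthant is the product of the
  propagators.
\<close>

section \<open>Trivalent trees and laminar families\<close>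

text \<open>The obstacle is that two orderings together destroy linear independence: already for n =
  4 the covectors of {1,2}, {1,3} and {2,3} add up to 0, so points of cones for different orderings
  cannot be compared by coefficients. Positivity and laminarity have to replace it. The additive
  constant in the ultrametric reflects the hyperplane equation of K_n; it disappears because neither
  family contains the whole of {1..n-1}, so that in each of them some pair of leaves lies in no
  common member. The cone is not computed exactly. It is enclosed in the set of nonnegative laminar
  combinations of each ordering, and the orthants of the common facets are shown to lie in it. Faces
  live in a function space without inner product. They are exposed by evaluation at a vertex of the
  associahedron, and a Farkas lemma identifies the points so exposed.\<close>

definition laminar :: "'a set set \<Rightarrow> bool"
  where "laminar F \<longleftrightarrow> (\<forall>S\<in>F. \<forall>T\<in>F. S \<subseteq> T \<or> T \<subseteq> S \<or> S \<inter> T = {})"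

lemma laminar_subset: "laminar G \<Longrightarrow> F \<subseteq> G \<Longrightarrow> laminar F"
  unfolding laminar_def by blast

text \<open>The root is included, unlike in \<open>internal_edges\<close>, so that the set of a tree
  is built from those of its two branches. A vertex is represented by the subtree hanging from
  it.\<close>

definition vertices :: "'a trivalent \<Rightarrow> 'a trivalent set"
  where "vertices g = {t. (t = g \<or> branch_of t g) \<and> (\<exists>p. t = Vertex p)}"

text \<open>The phylogenetic term. Single leaves are not clades here, while the full label set of a
  tree with at least two leaves is one; it is removed as \<open>{1..n-1}\<close> wherever facets are
  meant.\<close>

definition clades :: "'a trivalent \<Rightarrow> 'a set set"
  where "clades g = leaf_labels ` vertices g"

lemma branch_of_Leaf [simp]: "\<not> branch_of t (Leaf i)"
  by (auto elim: branch_of.cases)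

lemma branch_of_Vertex [simp]:
  "branch_of t (Vertex (Upair l r)) \<longleftrightarrow> t = l \<or> t = r \<or> branch_of t l \<or> branch_of t r"
  by (auto elim: branch_of.cases intro: branch_of.intros)

lemma vertices_Leaf [simp]: "vertices (Leaf i) = {}"
  by (auto simp: vertices_def)

lemma vertices_Vertex [simp]:
  "vertices (Vertex (Upair l r)) = insert (Vertex (Upair l r)) (vertices l \<union> vertices r)"
  by (auto simp: vertices_def)

lemma internal_edges_Vertex:
  "internal_edges (Vertex (Upair l r)) = vertices l \<union> vertices r"
  by (auto simp: vertices_def internal_edges_def)

lemma clades_Leaf [simp]: "clades (Leaf i) = {}"
  by (simp add: clades_def)

lemma clades_Vertex [simp]:
  "clades (Vertex (Upair l r)) =
     insert (leaf_labels l \<union> leaf_labels r) (clades l \<union> clades r)"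
  by (simp add: clades_def image_Un)

lemma labelled_by_leaf_labels: "labelled_by A g \<Longrightarrow> leaf_labels g = A"
  by (induction rule: labelled_by.induct) auto

lemma labelled_by_finite: "labelled_by A g \<Longrightarrow> finite A"
  by (induction rule: labelled_by.induct) auto

lemma labelled_by_nonempty: "labelled_by A g \<Longrightarrow> A \<noteq> {}"
  by (induction rule: labelled_by.induct) auto

lemma clades_subset: "labelled_by A g \<Longrightarrow> S \<in> clades g \<Longrightarrow> S \<subseteq> A"
  by (induction rule: labelled_by.induct) (auto simp: labelled_by_leaf_labels)

lemma clades_nonempty: "labelled_by A g \<Longrightarrow> S \<in> clades g \<Longrightarrow> S \<noteq> {}"
  by (induction rule: labelled_by.induct) (auto simp: labelled_by_leaf_labels labelled_by_nonempty)

lemma finite_vertices: "labelled_by A g \<Longrightarrow> finite (vertices g)"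
  by (induction rule: labelled_by.induct) auto

lemma clades_disjoint:
  assumes "labelled_by A l" "labelled_by B r" "A \<inter> B = {}"
  shows "clades l \<inter> clades r = {}" "A \<union> B \<notin> clades l" "A \<union> B \<notin> clades r"
proof -
  show "clades l \<inter> clades r = {}"
    using clades_subset[OF assms(1)] clades_subset[OF assms(2)] clades_nonempty[OF assms(1)] assms(3)
    by fast
  show "A \<union> B \<notin> clades l" "A \<union> B \<notin> clades r"
    using clades_subset[OF assms(1)] clades_subset[OF assms(2)] labelled_by_nonempty[OF assms(1)]
      labelled_by_nonempty[OF assms(2)] assms(3) by blast+
qed

text \<open>A binary tree has one internal vertex fewer than leaves, and disjointness of the
  branches keeps the label sets of different vertices apart. The count is what later makes the
  families of trees maximal.\<close>

lemma card_clades: "labelled_by A g \<Longrightarrow> Suc (card (clades g)) = card A"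
proof (induction rule: labelled_by.induct)
  case (2 A l B r)
  have fin: "finite (clades l)" "finite (clades r)"
    using finite_vertices 2 by (auto simp: clades_def)
  have "card (clades (Vertex (Upair l r))) = Suc (card (clades l) + card (clades r))"
    using clades_disjoint[OF "2.hyps"] fin 2
    by (simp add: labelled_by_leaf_labels card_Un_disjoint)
  moreover have "card (A \<union> B) = card A + card B"
    using labelled_by_finite 2 by (intro card_Un_disjoint) auto
  ultimately show ?case using 2 by simp
qed simp

lemma laminar_clades: "labelled_by A g \<Longrightarrow> laminar (clades g)"
proof (induction rule: labelled_by.induct)
  case (2 A l B r)
  show ?case
    unfolding laminar_def
  proof (intro ballI)
    fix S T assume "S \<in> clades (Vertex (Upair l r))" "T \<in> clades (Vertex (Upair l r))"
    then consider "S = A \<union> B" | "T = A \<union> B" | "S \<in> clades l" "T \<in> clades l"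
      | "S \<in> clades r" "T \<in> clades r" | "S \<in> clades l" "T \<in> clades r"
      | "S \<in> clades r" "T \<in> clades l"
      using 2 by (auto simp: labelled_by_leaf_labels)
    then show "S \<subseteq> T \<or> T \<subseteq> S \<or> S \<inter> T = {}"
    proof cases
      case 1
      have "T \<subseteq> A \<union> B"
        using clades_subset[OF labelled_by.intros(2)[OF "2.hyps"]] \<open>T \<in> _\<close> by blast
      then show ?thesis using 1 by blast
    next
      case 2
      have "S \<subseteq> A \<union> B"
        using clades_subset[OF labelled_by.intros(2)[OF "2.hyps"]] \<open>S \<in> _\<close> by blast
      then show ?thesis using 2 by blast
    next
      case 3 then show ?thesis using "2.IH"(1) unfolding laminar_def by blast
    next
      case 4 then show ?thesis using "2.IH"(2) unfolding laminar_def by blast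
    next
      case 5 then show ?thesis
        using clades_subset[OF "2.hyps"(1)] clades_subset[OF "2.hyps"(2)] "2.hyps"(3) by blast
    next
      case 6 then show ?thesis
        using clades_subset[OF "2.hyps"(1)] clades_subset[OF "2.hyps"(2)] "2.hyps"(3) by blast
    qed
  qed
qed (simp add: laminar_def)

text \<open>Counting: there are fewer vertices than leaves, and by \<open>card_clades\<close> their
  label sets already number one less than the leaves, so no two coincide.\<close>

lemma inj_on_leaf_labels_vertices: "labelled_by A g \<Longrightarrow> inj_on leaf_labels (vertices g)"
proof -
  assume g: "labelled_by A g"
  have "card (vertices g) < card A"
    using g
  proof (induction rule: labelled_by.induct)
    case (2 A l B r)
    have "card (vertices (Vertex (Upair l r))) \<le> Suc (card (vertices l) + card (vertices r))"
      using card_Un_le[of "vertices l" "vertices r"]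
      by (simp add: card_insert_if finite_vertices[OF 2(1)] finite_vertices[OF 2(2)])
    moreover have "card (A \<union> B) = card A + card B"
      using labelled_by_finite 2 by (intro card_Un_disjoint) auto
    ultimately show ?case using 2 by simp
  qed simp
  with card_clades[OF g] card_image_le[OF finite_vertices[OF g], of leaf_labels] show ?thesis
    by (intro eq_card_imp_inj_on finite_vertices[OF g]) (auto simp: clades_def)
qed

lemma clades_branch:
  assumes "labelled_by A l" "labelled_by B r" "A \<inter> B = {}"
  shows "clades l = {S \<in> clades (Vertex (Upair l r)). S \<subseteq> A}"
    and "clades r = {S \<in> clades (Vertex (Upair l r)). S \<subseteq> B}"
proof -
  note sub = clades_subset[OF assms(1)] clades_subset[OF assms(2)]
  note ne = clades_nonempty[OF assms(1)] clades_nonempty[OF assms(2)]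
    labelled_by_nonempty[OF assms(1)] labelled_by_nonempty[OF assms(2)]
  have "\<not> S \<subseteq> A" if "S \<in> clades r" for S using sub(2) ne(2) that assms(3) by blast
  moreover have "\<not> S \<subseteq> B" if "S \<in> clades l" for S using sub(1) ne(1) that assms(3) by blast
  moreover have "\<not> A \<union> B \<subseteq> A" "\<not> A \<union> B \<subseteq> B" using ne(3,4) assms(3) by blast+
  ultimately show "clades l = {S \<in> clades (Vertex (Upair l r)). S \<subseteq> A}"
    "clades r = {S \<in> clades (Vertex (Upair l r)). S \<subseteq> B}"
    using sub(1,2) by (simp_all add: labelled_by_leaf_labels[OF assms(1)]
        labelled_by_leaf_labels[OF assms(2)]) blast+
qed

text \<open>The root split can be read off. Each branch of one tree is a leaf or has a clade of the
  other tree as label set, and not being everything it lies within one branch there. Two splits of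
  the same set related in this way agree up to a swap, which \<open>Upair\<close> absorbs.\<close>

lemma clades_injective:
  "labelled_by A g \<Longrightarrow> labelled_by A h \<Longrightarrow> clades g = clades h \<Longrightarrow> g = h"
proof (induction arbitrary: h rule: labelled_by.induct)
  case (1 i)
  from 1(1) show ?case
  proof cases
    case (2 B l C r)
    then have "B \<noteq> {}" "C \<noteq> {}" "B \<subseteq> {i}" "C \<subseteq> {i}"
      using labelled_by_nonempty[of B l] labelled_by_nonempty[of C r] by auto
    then have "B = {i}" "C = {i}" by auto
    with \<open>B \<inter> C = {}\<close> show ?thesis by simp
  qed auto
next
  case (2 A l B r)
  have branch: "A' \<subseteq> C \<or> A' \<subseteq> D"
    if "labelled_by A' t" "clades t \<subseteq> clades (Vertex (Upair l' r'))" "labelled_by C l'"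
      "labelled_by D r'" "\<not> C \<union> D \<subseteq> A'" "A' \<subseteq> C \<union> D" for A' t C l' D r'
    using that(1)
  proof cases
    case (2 B1 t1 B2 t2)
    then have "A' \<in> clades t" by (simp add: labelled_by_leaf_labels)
    then have "A' \<in> clades l' \<or> A' \<in> clades r'"
      using that(2,5) by (auto simp: labelled_by_leaf_labels[OF that(3)] labelled_by_leaf_labels[OF that(4)])
    then show ?thesis
      using clades_subset[OF that(3)] clades_subset[OF that(4)] by blast
  qed (use that(6) in auto)
  from 2(6) show ?case
  proof cases
    case (1 i)
    then have "A \<subseteq> {i}" "B \<subseteq> {i}" by auto
    then have "A = {i}" "B = {i}"
      using labelled_by_nonempty[OF "2.hyps"(1)] labelled_by_nonempty[OF "2.hyps"(2)] by auto
    then show ?thesis using "2.hyps"(3) by simp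
  next
    case (2 C l' D r')
    note h = 2
    note ne = labelled_by_nonempty[OF "2.hyps"(1)] labelled_by_nonempty[OF "2.hyps"(2)]
      labelled_by_nonempty[OF h(3)] labelled_by_nonempty[OF h(4)]
    have eq: "clades (Vertex (Upair l r)) = clades (Vertex (Upair l' r'))"
      using "2.prems"(2) h(2) by (simp only:)
    have sub: "clades l \<subseteq> clades (Vertex (Upair l' r'))" "clades r \<subseteq> clades (Vertex (Upair l' r'))"
      unfolding eq[symmetric] by auto
    have nsub: "\<not> C \<union> D \<subseteq> A" "\<not> C \<union> D \<subseteq> B" "A \<subseteq> C \<union> D" "B \<subseteq> C \<union> D"
      using ne(1,2) "2.hyps"(3) unfolding h(1)[symmetric] by blast+
    have "A \<subseteq> C \<or> A \<subseteq> D" "B \<subseteq> C \<or> B \<subseteq> D"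
      by (rule branch[OF "2.hyps"(1) sub(1) h(3,4) nsub(1,3)]
          branch[OF "2.hyps"(2) sub(2) h(3,4) nsub(2,4)])+
    moreover have "\<not> (A \<subseteq> C \<and> B \<subseteq> C)" "\<not> (A \<subseteq> D \<and> B \<subseteq> D)"
      using h(1,5) ne(3,4) by auto
    moreover have "A = C" "B = D" if "A \<subseteq> C" "B \<subseteq> D"
      using h(1,5) that by auto
    moreover have "A = D" "B = C" if "A \<subseteq> D" "B \<subseteq> C"
      using h(1,5) that by auto
    ultimately consider "A = C" "B = D" | "A = D" "B = C"
      by metis
    then show ?thesis
    proof cases
      case 1
      have "clades l = clades l'" "clades r = clades r'"
        by (simp_all only: clades_branch[OF "2.hyps"] clades_branch[OF h(3-5)] eq 1)
      then show ?thesis using "2.IH" h(2-4) 1 by simp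
    next
      case 2
      have "clades l = clades r'" "clades r = clades l'"
        by (simp_all only: clades_branch[OF "2.hyps"] clades_branch[OF h(3-5)] eq 2)
      then show ?thesis using "2.IH" h(2-4) 2 by simp
    qed
  qed
qed

lemma drawn_with_labelled_by: "drawn_with g xs \<Longrightarrow> distinct xs \<Longrightarrow> labelled_by (set xs) g"
proof (induction rule: drawn_with.induct)
  case (1 i)
  show ?case using labelled_by.intros(1)[of i] by simp
next
  case (2 l xs r ys)
  then show ?case using labelled_by.intros(2)[of "set xs" l "set ys" r] by simp
qed

lemma drawn_with_nonempty: "drawn_with g xs \<Longrightarrow> xs \<noteq> []"
  by (induction rule: drawn_with.induct) auto

lemma append_eq_map_upt:
  assumes "xs @ ys = map f [a..<b]" "xs \<noteq> []" "ys \<noteq> []"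
  obtains m where "a < m" "m < b" "xs = map f [a..<m]" "ys = map f [m..<b]"
proof
  have len: "length xs + length ys = b - a"
    using arg_cong[OF assms(1), of length] by simp
  show "a < a + length xs" using assms by simp
  show "a + length xs < b" using len assms by (cases ys) auto
  then show "xs = map f [a..<a + length xs]" "ys = map f [a + length xs..<b]"
    using arg_cong[OF assms(1), of "take (length xs)"] arg_cong[OF assms(1), of "drop (length xs)"]
    by (simp_all add: take_map drop_map)
qed

text \<open>The leaves below a vertex of a drawing occupy an interval of positions. Induction over
  intervals with a split position \<open>m\<close> replaces induction over lists, and sums over
  pairs of leaves are later cut at the same \<open>m\<close>.\<close>

lemma drawn_interval_induct [consumes 1, case_names Leaf Vertex]:
  assumes "drawn_with g (map f [a..<b])"
    and "\<And>a. P (Leaf (f a)) a (Suc a)"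
    and "\<And>l r a m b. a < m \<Longrightarrow> m < b \<Longrightarrow> drawn_with l (map f [a..<m]) \<Longrightarrow> P l a m \<Longrightarrow>
      drawn_with r (map f [m..<b]) \<Longrightarrow> P r m b \<Longrightarrow> P (Vertex (Upair l r)) a b"
  shows "P g a b"
  using assms(1)
proof (induction g "map f [a..<b]" arbitrary: a b rule: drawn_with.induct)
  case (1 i)
  have "b - a = 1" using arg_cong[OF 1, of length] by simp
  then have "b = Suc a" by simp
  with 1 have "i = f a" by simp
  with \<open>b = Suc a\<close> show ?case using assms(2) by simp
next
  case (2 l xs r ys)
  then obtain m where m: "a < m" "m < b" "xs = map f [a..<m]" "ys = map f [m..<b]"
    using append_eq_map_upt drawn_with_nonempty by metis
  then show ?case using 2 assms(3)[of a m b l r] by simp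
qed

definition segments :: "(nat \<Rightarrow> 'a) \<Rightarrow> nat \<Rightarrow> nat \<Rightarrow> 'a set set"
  where "segments f a b = {f ` {i..<j} | i j. a \<le> i \<and> Suc i < j \<and> j \<le> b}"

lemma leaf_labels_drawn:
  "drawn_with g (map f [a..<b]) \<Longrightarrow> leaf_labels g = f ` {a..<b}"
proof (induction rule: drawn_interval_induct)
  case (Vertex l r a m b)
  then have "{a..<b} = {a..<m} \<union> {m..<b}" by auto
  with Vertex show ?case by (simp add: image_Un)
qed simp

lemma clades_drawn_segments:
  "drawn_with g (map f [a..<b]) \<Longrightarrow> clades g \<subseteq> segments f a b"
proof (induction rule: drawn_interval_induct)
  case (Vertex l r a m b)
  then have e: "leaf_labels l \<union> leaf_labels r = f ` {a..<b}"
    using ivl_disj_un_two(3)[of a m b] by (simp add: leaf_labels_drawn flip: image_Un)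
  have "f ` {a..<b} \<in> segments f a b"
    using Vertex unfolding segments_def by force
  moreover have "segments f a m \<subseteq> segments f a b" "segments f m b \<subseteq> segments f a b"
    using Vertex(1,2) by (fastforce simp: segments_def)+
  ultimately show ?case using Vertex e by auto
qed simp

text \<open>The root has to be split where no member of \<open>F\<close> other than the whole block
  is cut. The end of the longest proper prefix in \<open>F\<close> is such a place: a smaller member
  cut there would be a longer prefix or would cross that prefix.\<close>

lemma laminar_segments_extend:
  assumes "a < b" "inj_on f {a..<b}" "F \<subseteq> segments f a b" "laminar F"
  shows "\<exists>g. drawn_with g (map f [a..<b]) \<and> F \<subseteq> clades g"
  using assms
proof (induction "b - a" arbitrary: a b F rule: less_induct)
  case less
  show ?case
  proof (cases "b = Suc a")
    case True
    then have "F = {}" using less(4) by (auto simp: segments_def)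
    then show ?thesis using True drawn_with.intros(1)[of "f a"] by auto
  next
    case False
    \<comment> \<open>\<open>Suc a\<close> is the default when no proper prefix is in
      \<open>F\<close>: it splits off the first leaf alone.\<close>
    define M where "M = {m. a < m \<and> m < b \<and> (m = Suc a \<or> f ` {a..<m} \<in> F)}"
    define m where "m = Max M"
    have "finite M" "Suc a \<in> M"
      unfolding M_def using less(2) False by auto
    then have mM: "m \<in> M" and max: "\<And>k. k \<in> M \<Longrightarrow> k \<le> m"
      unfolding m_def by (auto intro: Max_in)
    have m: "a < m" "m < b" "m = Suc a \<or> f ` {a..<m} \<in> F"
      using mM by (auto simp: M_def)
    have inj: "f u = f v \<longleftrightarrow> u = v" if "u \<in> {a..<b}" "v \<in> {a..<b}" for u v
      using less(3) that by (auto simp: inj_on_def)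
    have split: "S \<in> segments f a m \<or> S \<in> segments f m b \<or> S = f ` {a..<b}" if "S \<in> F" for S
    proof -
      obtain i j where S: "S = f ` {i..<j}" "a \<le> i" "Suc i < j" "j \<le> b"
        using \<open>S \<in> F\<close> less(4) by (auto simp: segments_def)
      have "S = f ` {a..<b}" if ij: "i < m" "m < j"
      proof (cases "i = a")
        case True
        have "j \<notin> M" using max ij by force
        then have "j = b" using S True that \<open>S \<in> F\<close> m by (auto simp: M_def)
        then show ?thesis using S True by simp
      next
        case False
        then have "f ` {a..<m} \<in> F" using m S ij by auto
        then have "f ` {a..<m} \<subseteq> S \<or> S \<subseteq> f ` {a..<m} \<or> f ` {a..<m} \<inter> S = {}"
          using less(5) \<open>S \<in> F\<close> unfolding laminar_def by blast
        moreover have "f a \<notin> S" "f m \<notin> f ` {a..<m}"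
          using inj S False m by (auto simp: image_iff)
        moreover have "f a \<in> f ` {a..<m}" "f i \<in> f ` {a..<m}" "f i \<in> S" "f m \<in> S"
          using S ij m by auto
        ultimately show ?thesis by blast
      qed
      then show ?thesis using S unfolding segments_def
        by (metis (mono_tags, lifting) leI mem_Collect_eq)
    qed
    have "\<exists>g. drawn_with g (map f [a..<m]) \<and> F \<inter> segments f a m \<subseteq> clades g"
      using less m laminar_subset[OF less(5)] inj_on_subset[OF less(3)] by (intro less(1)) auto
    moreover have "\<exists>g. drawn_with g (map f [m..<b]) \<and> F \<inter> segments f m b \<subseteq> clades g"
      using less m laminar_subset[OF less(5)] inj_on_subset[OF less(3)] by (intro less(1)) auto
    ultimately obtain l r where
      l: "drawn_with l (map f [a..<m])" "F \<inter> segments f a m \<subseteq> clades l" and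
      r: "drawn_with r (map f [m..<b])" "F \<inter> segments f m b \<subseteq> clades r" by blast
    have "map f [a..<m] @ map f [m..<b] = map f [a..<b]"
      using m upt_add_eq_append[of a m "b - m"] by (simp flip: map_append)
    moreover have "f ` {a..<m} \<union> f ` {m..<b} = f ` {a..<b}"
      using m ivl_disj_un_two(3)[of a m b] by (simp flip: image_Un)
    ultimately have "drawn_with (Vertex (Upair l r)) (map f [a..<b])"
      and full: "leaf_labels l \<union> leaf_labels r = f ` {a..<b}"
      using drawn_with.intros(2)[OF l(1) r(1)] leaf_labels_drawn[OF l(1)] leaf_labels_drawn[OF r(1)] by simp_all
    moreover have "F \<subseteq> clades (Vertex (Upair l r))"
    proof
      fix S assume "S \<in> F"
      then show "S \<in> clades (Vertex (Upair l r))"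
        using split[OF \<open>S \<in> F\<close>] l(2) r(2) unfolding clades_Vertex full by blast
    qed
    ultimately show ?thesis by (intro exI conjI)
  qed
qed

section \<open>Points of kinematic space\<close>

text \<open>In the positions of an ordering this is the Mandelstam variable of the block from
  \<open>i\<close> to \<open>j - 1\<close>. Only entries with \<open>u < v\<close> are read, so
  \<open>s\<close> may be any formula that makes sense above the diagonal.\<close>

definition pair_sum :: "(nat \<Rightarrow> nat \<Rightarrow> real) \<Rightarrow> nat \<Rightarrow> nat \<Rightarrow> real"
  where "pair_sum s i j = (\<Sum>u\<in>{i..<j}. \<Sum>v\<in>{Suc u..<j}. s u v)"

lemma pair_sum_split:
  assumes "i \<le> m" "m \<le> j"
  shows "pair_sum s i j = pair_sum s i m + pair_sum s m j + (\<Sum>u\<in>{i..<m}. \<Sum>v\<in>{m..<j}. s u v)"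
proof -
  have "pair_sum s i j = (\<Sum>u\<in>{i..<m}. \<Sum>v\<in>{Suc u..<j}. s u v) + pair_sum s m j"
    unfolding pair_sum_def using assms by (simp add: sum.atLeastLessThan_concat)
  also have "(\<Sum>u\<in>{i..<m}. \<Sum>v\<in>{Suc u..<j}. s u v)
      = (\<Sum>u\<in>{i..<m}. (\<Sum>v\<in>{Suc u..<m}. s u v) + (\<Sum>v\<in>{m..<j}. s u v))"
    using assms by (intro sum.cong refl) (simp add: sum.atLeastLessThan_concat)
  finally show ?thesis by (simp add: pair_sum_def sum.distrib)
qed

lemma pair_sum_trivial: "j \<le> Suc i \<Longrightarrow> pair_sum s i j = 0"
  unfolding pair_sum_def by (intro sum.neutral) auto

lemma pair_sum_cong:
  "(\<And>u v. i \<le> u \<Longrightarrow> u < v \<Longrightarrow> v < j \<Longrightarrow> s u v = t u v) \<Longrightarrow> pair_sum s i j = pair_sum t i j"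
  unfolding pair_sum_def by (intro sum.cong refl) auto

lemma double_sum_symmetric:
  assumes "\<And>u v. f u v = f v u" "\<And>u. f u u = (0::real)"
  shows "(\<Sum>u\<in>{i..<j}. \<Sum>v\<in>{i..<j}. f u v) = 2 * pair_sum f i j"
proof (induction j)
  case (Suc j)
  show ?case
  proof (cases "i \<le> j")
    case True
    have "(\<Sum>v\<in>{i..<j}. f j v) = (\<Sum>v\<in>{i..<j}. f v j)"
      using assms(1) by (intro sum.cong) auto
    then show ?thesis
      using Suc True pair_sum_split[of i j "Suc j" f] pair_sum_trivial[of "Suc j" j f] assms(2)
      by (simp add: sum.distrib)
  qed (simp add: pair_sum_def)
qed (simp add: pair_sum_def)

lemma mandelstam_double_sum:
  assumes "finite S" "\<And>i j. Z i j = Z j i" "\<And>i. Z i i = 0"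
  shows "2 * mandelstam S Z = (\<Sum>i\<in>S. \<Sum>j\<in>S. Z i j)"
proof -
  let ?L = "{(i, j). i \<in> S \<and> j \<in> S \<and> i < j}" and ?G = "{(i, j). i \<in> S \<and> j \<in> S \<and> j < i}"
  have fin: "finite ?L" "finite ?G"
    using assms(1) by (auto intro: finite_subset[of _ "S \<times> S"])
  have "(\<Sum>i\<in>S. \<Sum>j\<in>S. Z i j) = (\<Sum>(i, j)\<in>S \<times> S. Z i j)"
    by (simp add: sum.cartesian_product)
  also have "\<dots> = (\<Sum>(i, j)\<in>?L \<union> ?G. Z i j)"
    using assms by (intro sum.mono_neutral_right) (auto simp: not_less_iff_gr_or_eq)
  also have "\<dots> = (\<Sum>(i, j)\<in>?L. Z i j) + (\<Sum>(i, j)\<in>?G. Z i j)"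
    using fin by (intro sum.union_disjoint) auto
  also have "(\<Sum>(i, j)\<in>?G. Z i j) = (\<Sum>(i, j)\<in>?L. Z i j)"
    by (rule sum.reindex_bij_witness[of _ prod.swap prod.swap]) (auto simp: assms(2))
  finally show ?thesis by (simp add: mandelstam_def)
qed

lemma kin_K_symmetric:
  assumes "Z \<in> kin_K n"
  shows "Z i j = Z j i" "Z i i = 0"
  using assms by (auto simp: kin_K_def kin_V_def)

lemma covector_mandelstam:
  assumes "Z \<in> kin_K n" "finite S"
  shows "covector n S Z = - mandelstam S Z"
proof -
  have "2 * mandelstam S Z = (\<Sum>i\<in>S. \<Sum>j\<in>S. Z i j)"
    using mandelstam_double_sum[OF assms(2), of Z] kin_K_symmetric[OF assms(1)] by blast
  then show ?thesis using assms(1) by (simp add: covector_def)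
qed

lemma covector_segment:
  assumes "Z \<in> kin_K n" "inj_on f {i..<j}"
  shows "covector n (f ` {i..<j}) Z = - pair_sum (\<lambda>u v. Z (f u) (f v)) i j"
proof -
  have "(\<Sum>u\<in>{i..<j}. \<Sum>v\<in>{i..<j}. Z (f u) (f v)) = 2 * pair_sum (\<lambda>u v. Z (f u) (f v)) i j"
    using kin_K_symmetric[OF assms(1)] by (intro double_sum_symmetric)
  then show ?thesis
    using assms by (simp add: covector_def sum.reindex)
qed

lemma ordering_bij:
  assumes "is_ordering n f"
  shows "inj_on f {1..<n}" "f ` {1..<n} = {1..n-1}" "inj_on f {1..n}"
proof -
  have b: "bij_betw f {1..n} {1..n}" and n: "f n = n" using assms by (auto simp: is_ordering_def)
  show "inj_on f {1..n}" using b by (auto simp: bij_betw_def)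
  then show "inj_on f {1..<n}" by (rule inj_on_subset) auto
  have "f ` ({1..n} - {n}) = {1..n} - {n}"
    using b n \<open>inj_on f {1..n}\<close> by (cases "n = 0") (auto simp: inj_on_image_set_diff[of f "{1..n}"] bij_betw_def)
  moreover have "{1..n} - {n} = {1..<n}" "{1..n} - {n} = {1..n-1}" by auto
  ultimately show "f ` {1..<n} = {1..n-1}" by simp
qed

text \<open>The entries above the diagonal, in the order of \<open>f\<close>, are free coordinates
  of a symmetric matrix with zero diagonal; the hypothesis on \<open>s\<close> is the hyperplane
  equation.\<close>

lemma kinematic_point:
  assumes f: "is_ordering n f" and s: "pair_sum s 1 n = 0"
  obtains Z where "Z \<in> kin_K n" "\<And>u v. 1 \<le> u \<Longrightarrow> u < v \<Longrightarrow> v < n \<Longrightarrow> Z (f u) (f v) = s u v"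
proof -
  define g where "g = inv_into {1..<n} f"
  have g: "g (f u) = u" if "1 \<le> u" "u < n" for u
    unfolding g_def using ordering_bij(1)[OF f] that by (intro inv_into_f_f) auto
  define Z where "Z x y = (if x \<in> {1..n-1} \<and> y \<in> {1..n-1} then
      if g x < g y then s (g x) (g y) else if g y < g x then s (g y) (g x) else 0 else 0)" for x y
  have Z: "Z (f u) (f v) = s u v" if "1 \<le> u" "u < v" "v < n" for u v
  proof -
    have "f u \<in> f ` {1..<n}" "f v \<in> f ` {1..<n}" using that by auto
    then show ?thesis using that by (simp only: ordering_bij(2)[OF f] Z_def g) auto
  qed
  have sym: "Z x y = Z y x" and diag: "Z x x = 0" for x y by (auto simp: Z_def)
  have "2 * mandelstam {1..n-1} Z = (\<Sum>x\<in>f ` {1..<n}. \<Sum>y\<in>f ` {1..<n}. Z x y)"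
    unfolding ordering_bij(2)[OF f] using sym diag by (intro mandelstam_double_sum) auto
  also have "\<dots> = (\<Sum>u\<in>{1..<n}. \<Sum>v\<in>{1..<n}. Z (f u) (f v))"
    using ordering_bij(1)[OF f] by (simp add: sum.reindex)
  also have "\<dots> = 2 * pair_sum (\<lambda>u v. Z (f u) (f v)) 1 n"
    using sym diag by (intro double_sum_symmetric)
  also have "pair_sum (\<lambda>u v. Z (f u) (f v)) 1 n = pair_sum s 1 n"
    using Z by (intro pair_sum_cong) auto
  finally have "mandelstam {1..n-1} Z = 0" using s by simp
  moreover have "Z x y = 0" if "x \<notin> {1..n-1}" for x y using that by (auto simp: Z_def)
  ultimately have "Z \<in> kin_K n"
    using sym diag unfolding kin_K_def kin_V_def by blast
  with Z that show thesis by blast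
qed

text \<open>The summand is a mixed second difference, so both sums telescope, and the boundary terms
  vanish by the condition on \<open>X\<close>. This inverts the passage from the entries s_ij to the
  planar variables, the sums over blocks.\<close>

lemma pair_sum_second_difference:
  assumes "\<And>i j. j \<le> Suc i \<Longrightarrow> X i j = 0" "i \<le> j"
  shows "pair_sum (\<lambda>u v. X u (Suc v) - X (Suc u) (Suc v) - (X u v - X (Suc u) v)) i j = X i j"
proof -
  have "(\<Sum>v\<in>{Suc u..<j}. X u (Suc v) - X (Suc u) (Suc v) - (X u v - X (Suc u) v)) = X u j - X (Suc u) j"
    if "u < j" for u
    using sum_Suc_diff'[of "Suc u" j "\<lambda>v. X u v - X (Suc u) v"] that assms(1) by simp
  then have "pair_sum (\<lambda>u v. X u (Suc v) - X (Suc u) (Suc v) - (X u v - X (Suc u) v)) i j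
      = (\<Sum>u\<in>{i..<j}. X u j - X (Suc u) j)"
    unfolding pair_sum_def by (intro sum.cong) auto
  also have "\<dots> = X i j - X j j"
    using sum_Suc_diff'[OF assms(2), of "\<lambda>u. - X u j"] by simp
  finally show ?thesis using assms(1) by simp
qed

lemma kinematic_point_planar:
  fixes X :: "nat \<Rightarrow> nat \<Rightarrow> real"
  assumes f: "is_ordering n f" and "n \<ge> 1"
    and X: "\<And>i j. j \<le> Suc i \<Longrightarrow> X i j = 0" "X 1 n = 0"
  obtains Z where "Z \<in> kin_K n"
    "\<And>i j. 1 \<le> i \<Longrightarrow> i \<le> j \<Longrightarrow> j \<le> n \<Longrightarrow> covector n (f ` {i..<j}) Z = X i j"
proof -
  \<comment> \<open>Second differences of \<open>- X\<close>: the sign is reversed because a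
    covector is minus the block sum.\<close>
  define s where "s u v = - X u (Suc v) - - X (Suc u) (Suc v) - (- X u v - - X (Suc u) v)" for u v
  have s: "pair_sum s i j = - X i j" if "i \<le> j" for i j
    unfolding s_def using pair_sum_second_difference[of "\<lambda>i j. - X i j" i j] X(1) that by simp
  have "pair_sum s 1 n = 0" using s[of 1 n] X(2) assms(2) by simp
  then obtain Z where Z: "Z \<in> kin_K n"
    "\<And>u v. 1 \<le> u \<Longrightarrow> u < v \<Longrightarrow> v < n \<Longrightarrow> Z (f u) (f v) = s u v"
    using kinematic_point[OF f] by blast
  have "covector n (f ` {i..<j}) Z = X i j" if "1 \<le> i" "i \<le> j" "j \<le> n" for i j
  proof -
    have "inj_on f {i..<j}" using ordering_bij(1)[OF f] by (rule inj_on_subset) (use that in auto)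
    moreover have "pair_sum (\<lambda>u v. Z (f u) (f v)) i j = pair_sum s i j"
      using that by (intro pair_sum_cong Z(2)) auto
    ultimately show ?thesis using covector_segment[OF Z(1)] s that by simp
  qed
  with Z(1) that show thesis by blast
qed

lemma full_clade:
  "drawn_with g (map f [a..<b]) \<Longrightarrow> Suc a < b \<Longrightarrow> f ` {a..<b} \<in> clades g"
proof (induction rule: drawn_interval_induct)
  case (Vertex l r a m b)
  then show ?case
    using ivl_disj_un_two(3)[of a m b] by (simp add: leaf_labels_drawn flip: image_Un)
qed simp

lemma image_interval_eq_iff:
  assumes "inj_on f {a..<b::nat}" "a \<le> i" "i < j" "j \<le> b" "a \<le> i'" "i' < j'" "j' \<le> b"
  shows "f ` {i..<j} = f ` {i'..<j'} \<longleftrightarrow> i = i' \<and> j = j'"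
proof -
  have "f ` {i..<j} = f ` {i'..<j'} \<longleftrightarrow> {i..<j} = {i'..<j'}"
    using assms by (intro inj_on_image_eq_iff) auto
  then show ?thesis using atLeastLessThan_eq_iff[of i j i' j'] assms by simp
qed

text \<open>The value at the split position of a vertex is forced: it makes the sum over all pairs
  separated by that vertex vanish.\<close>

lemma vertex_heights:
  assumes "drawn_with g (map f [a..<b])" "inj_on f {a..<b}"
    and "\<And>u v. a \<le> u \<Longrightarrow> Suc u < v \<Longrightarrow> v < b \<Longrightarrow> c u v > (0::real)"
  shows "\<exists>h. \<forall>i j. a \<le> i \<longrightarrow> Suc i < j \<longrightarrow> j \<le> b \<longrightarrow>
    (if f ` {i..<j} \<in> clades g then pair_sum (\<lambda>u v. if v = Suc u then h u else c u v) i j = 0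
     else pair_sum (\<lambda>u v. if v = Suc u then h u else c u v) i j < 0)"
  using assms
proof (induction rule: drawn_interval_induct)
  case (Leaf a)
  then show ?case by simp
next
  case (Vertex l r a m b)
  have inj: "inj_on f {a..<m}" "inj_on f {m..<b}"
    using Vertex.hyps Vertex.prems(1) by (auto elim: inj_on_subset)
  let ?s = "\<lambda>h u v. if v = Suc u then h u else c u v"
  obtain h1 where h1: "\<And>i j. a \<le> i \<Longrightarrow> Suc i < j \<Longrightarrow> j \<le> m \<Longrightarrow>
      if f ` {i..<j} \<in> clades l then pair_sum (?s h1) i j = 0 else pair_sum (?s h1) i j < 0"
    using Vertex.IH(1)[OF inj(1)] Vertex.prems(2) Vertex.hyps(2) by (meson less_trans)
  obtain h2 where h2: "\<And>i j. m \<le> i \<Longrightarrow> Suc i < j \<Longrightarrow> j \<le> b \<Longrightarrow>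
      if f ` {i..<j} \<in> clades r then pair_sum (?s h2) i j = 0 else pair_sum (?s h2) i j < 0"
    using Vertex.IH(2)[OF inj(2)] Vertex.prems(2) Vertex.hyps(1) by (meson less_imp_le_nat order_trans)
  \<comment> \<open>The pairs separated by the split, except the adjacent pair
    \<open>(m-1, m)\<close>, whose entry is the one still free; \<open>H\<close> makes the sum over
    all separated pairs vanish.\<close>
  define D where "D i j = {i..<m} \<times> {m..<j} - {(m-1, m)}" for i j
  define H where "H = - (\<Sum>(u, v)\<in>D a b. c u v)"
  define h where "h u = (if Suc u < m then h1 u else if m \<le> u then h2 u else H)" for u
  have left: "pair_sum (?s h) i j = pair_sum (?s h1) i j" if "j \<le> m" for i j
    by (rule pair_sum_cong) (use that in \<open>auto simp: h_def\<close>)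
  have right: "pair_sum (?s h) i j = pair_sum (?s h2) i j" if "m \<le> i" for i j
    by (rule pair_sum_cong) (use that in \<open>auto simp: h_def\<close>)
  have fin: "finite (D i j)" for i j by (simp add: D_def)
  \<comment> \<open>For a smaller block across the split, the positive constants that it misses are
    left over with a minus sign, which gives the strict inequality.\<close>
  have cross: "(\<Sum>u\<in>{i..<m}. \<Sum>v\<in>{m..<j}. ?s h u v) = - (\<Sum>(u, v)\<in>D a b - D i j. c u v)"
    if "a \<le> i" "i < m" "m < j" "j \<le> b" for i j
  proof -
    have "(\<Sum>u\<in>{i..<m}. \<Sum>v\<in>{m..<j}. ?s h u v) = (\<Sum>(u, v)\<in>{i..<m} \<times> {m..<j}. ?s h u v)"
      by (simp add: sum.cartesian_product)
    also have "\<dots> = ?s h (m-1) m + (\<Sum>(u, v)\<in>D i j. ?s h u v)"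
      unfolding D_def using that by (subst sum.remove[of _ "(m-1, m)"]) auto
    also have "?s h (m-1) m = H"
      using that by (cases m) (auto simp: h_def)
    also have "(\<Sum>(u, v)\<in>D i j. ?s h u v) = (\<Sum>(u, v)\<in>D i j. c u v)"
      by (intro sum.cong refl) (auto simp: D_def split: if_splits)
    also have "H + \<dots> = - (\<Sum>(u, v)\<in>D a b - D i j. c u v)"
      unfolding H_def using that by (subst sum_diff[OF fin]) (auto simp: D_def)
    finally show ?thesis .
  qed
  have full: "leaf_labels l \<union> leaf_labels r = f ` {a..<b}"
    using Vertex.hyps ivl_disj_un_two(3)[of a m b] by (simp add: leaf_labels_drawn flip: image_Un)
  have cl: "f ` {i..<j} \<in> clades l \<Longrightarrow> j \<le> m" and cr: "f ` {i..<j} \<in> clades r \<Longrightarrow> m \<le> i"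
    if ij: "a \<le> i" "Suc i < j" "j \<le> b" for i j
  proof -
    assume "f ` {i..<j} \<in> clades l"
    then obtain i' j' where "f ` {i..<j} = f ` {i'..<j'}" "a \<le> i'" "Suc i' < j'" "j' \<le> m"
      using clades_drawn_segments[OF Vertex.hyps(3)] unfolding segments_def by blast
    then show "j \<le> m"
      using image_interval_eq_iff[OF Vertex.prems(1), of i j i' j'] ij Vertex.hyps(2) by simp
  next
    assume "f ` {i..<j} \<in> clades r"
    then obtain i' j' where "f ` {i..<j} = f ` {i'..<j'}" "m \<le> i'" "Suc i' < j'" "j' \<le> b"
      using clades_drawn_segments[OF Vertex.hyps(4)] unfolding segments_def by blast
    then show "m \<le> i"
      using image_interval_eq_iff[OF Vertex.prems(1), of i j i' j'] ij Vertex.hyps(1) by simp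
  qed
  have cf: "f ` {i..<j} = f ` {a..<b} \<longleftrightarrow> i = a \<and> j = b" if "a \<le> i" "Suc i < j" "j \<le> b" for i j
    using image_interval_eq_iff[OF Vertex.prems(1), of i j a b] that by simp
  show ?case
  proof (intro exI[of _ h] allI impI)
    fix i j assume ij: "a \<le> i" "Suc i < j" "j \<le> b"
    consider "j \<le> m" | "m \<le> i" | "i < m" "m < j" by linarith
    then show "if f ` {i..<j} \<in> clades (Vertex (Upair l r)) then pair_sum (?s h) i j = 0
        else pair_sum (?s h) i j < 0"
    proof cases
      case 1
      then have "f ` {i..<j} \<in> clades (Vertex (Upair l r)) \<longleftrightarrow> f ` {i..<j} \<in> clades l"
        using cr[OF ij] cf[OF ij] ij Vertex.hyps(2) full by auto
      then show ?thesis using h1[of i j] left[OF 1, of i] 1 ij by simp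
    next
      case 2
      then have "f ` {i..<j} \<in> clades (Vertex (Upair l r)) \<longleftrightarrow> f ` {i..<j} \<in> clades r"
        using cl[OF ij] cf[OF ij] ij Vertex.hyps(1) full by auto
      then show ?thesis using h2[of i j] right[OF 2, of j] 2 ij by simp
    next
      case 3
      have "pair_sum (?s h) i j = pair_sum (?s h) i m + pair_sum (?s h) m j
          - (\<Sum>(u, v)\<in>D a b - D i j. c u v)"
        using pair_sum_split[of i m j "?s h"] cross[of i j] 3 ij by simp
      moreover have "pair_sum (?s h) i m \<le> 0"
      proof (cases "Suc i < m")
        case True
        then show ?thesis using h1[of i m] left[of m i] ij by (simp split: if_splits)
      qed (simp add: pair_sum_trivial)
      moreover have "pair_sum (?s h) m j \<le> 0"
      proof (cases "Suc m < j")
        case True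
        then show ?thesis using h2[of m j] right[of m j] ij by (simp split: if_splits)
      qed (simp add: pair_sum_trivial)
      moreover have "pair_sum (?s h) i j = 0" if "i = a" "j = b"
      proof -
        have "pair_sum (?s h) a m = 0"
        proof (cases "Suc a < m")
          case True
          then have "f ` {a..<m} \<in> clades l" using full_clade Vertex.hyps(3) by blast
          then show ?thesis using True h1[of a m] left[of m a] by simp
        qed (simp add: pair_sum_trivial)
        moreover have "pair_sum (?s h) m b = 0"
        proof (cases "Suc m < b")
          case True
          then have "f ` {m..<b} \<in> clades r" using full_clade Vertex.hyps(4) by blast
          then show ?thesis using True h2[of m b] right[of m b] by simp
        qed (simp add: pair_sum_trivial)
        ultimately show ?thesis
          using pair_sum_split[of a m b "?s h"] cross[of a b] 3 that by simp
      qed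
      moreover have "(\<Sum>(u, v)\<in>D a b - D i j. c u v) > 0" if "\<not> (i = a \<and> j = b)"
      proof (rule sum_pos)
        show "finite (D a b - D i j)" using fin by simp
        \<comment> \<open>A block that misses the left end misses the pair \<open>(a, m)\<close>,
          one that misses the right end the pair \<open>(m - 1, b - 1)\<close>; in that case the
          pair is not the adjacent one excluded from \<open>D\<close>.\<close>
        have "(a, m) \<in> D a b - D i j \<or> (m - 1, b - 1) \<in> D a b - D i j"
          using that ij 3 by (auto simp: D_def)
        then show "D a b - D i j \<noteq> {}" by blast
        fix x assume "x \<in> D a b - D i j"
        then show "(case x of (u, v) \<Rightarrow> c u v) > 0"
          by (auto simp: D_def intro!: Vertex.prems(2))
      qed
      moreover have "f ` {i..<j} \<in> clades (Vertex (Upair l r)) \<longleftrightarrow> i = a \<and> j = b"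
        using cl[OF ij] cr[OF ij] cf[OF ij] 3 full by auto
      ultimately show ?thesis by (smt (verit))
    qed
  qed
qed

section \<open>Farkas lemma and linear algebra of covectors\<close>

text \<open>Unlike in \<open>dual_space\<close>, nothing is asked outside \<open>U\<close>:
  covectors of K_n then qualify as functionals on the directions of the plane without being cut
  off.\<close>

definition functional_on :: "'v::real_vector set \<Rightarrow> ('v \<Rightarrow> real) \<Rightarrow> bool"
  where "functional_on U f \<longleftrightarrow> (\<forall>x\<in>U. \<forall>y\<in>U. f (x + y) = f x + f y) \<and> (\<forall>r. \<forall>x\<in>U. f (r *\<^sub>R x) = r * f x)"

lemma functional_on_diff:
  assumes "subspace U" "functional_on U f" "x \<in> U" "y \<in> U"
  shows "f (x - y) = f x - f y"
proof -
  have "f (x + (-1) *\<^sub>R y) = f x + (-1) * f y"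
    using assms unfolding functional_on_def by (metis subspace_scale)
  then show ?thesis by simp
qed

lemma functional_on_lincomb:
  "functional_on U f \<Longrightarrow> functional_on U g \<Longrightarrow> functional_on U (\<lambda>x. f x - r * g x)"
  by (auto simp: functional_on_def algebra_simps)

text \<open>Induction on the number of functionals, after Bartl: if the claim fails without the
  functional \<open>a m\<close>, a point witnessing this is used to project along onto the kernel of \<open>a m\<close>.\<close>

lemma farkas:
  fixes a :: "'i \<Rightarrow> 'v::real_vector \<Rightarrow> real"
  assumes "subspace U" "finite I" "\<And>i. i \<in> I \<Longrightarrow> functional_on U (a i)" "functional_on U c"
    and "\<And>x. x \<in> U \<Longrightarrow> (\<And>i. i \<in> I \<Longrightarrow> a i x \<ge> 0) \<Longrightarrow> c x \<ge> 0"
  shows "\<exists>\<mu>. (\<forall>i\<in>I. \<mu> i \<ge> 0) \<and> (\<forall>x\<in>U. c x = (\<Sum>i\<in>I. \<mu> i * a i x))"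
  using assms(2-5)
proof (induction I arbitrary: a c rule: finite_induct)
  case empty
  have "c x = 0" if "x \<in> U" for x
  proof -
    have "(-1) *\<^sub>R x \<in> U" using assms(1) that by (rule subspace_scale)
    then have "c ((-1) *\<^sub>R x) \<ge> 0" "c x \<ge> 0" using empty(3) that by blast+
    moreover have "c ((-1) *\<^sub>R x) = - 1 * c x"
      using empty(2) that unfolding functional_on_def by blast
    ultimately show ?thesis by simp
  qed
  then show ?case by simp
next
  case (insert m I)
  show ?case
  proof (cases "\<forall>x\<in>U. (\<forall>i\<in>I. a i x \<ge> 0) \<longrightarrow> c x \<ge> 0")
    case True
    then obtain \<mu> where "\<forall>i\<in>I. \<mu> i \<ge> 0" "\<forall>x\<in>U. c x = (\<Sum>i\<in>I. \<mu> i * a i x)"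
      using insert.IH[of a c] insert.prems by blast
    moreover from this have "(\<Sum>i\<in>I. (\<mu>(m := 0)) i * a i x) = (\<Sum>i\<in>I. \<mu> i * a i x)" for x
      using insert.hyps by (intro sum.cong) auto
    ultimately show ?thesis
      using insert.hyps by (intro exI[of _ "\<mu>(m := 0)"]) simp
  next
    case False
    then obtain x0 where x0: "x0 \<in> U" "\<forall>i\<in>I. a i x0 \<ge> 0" "c x0 < 0" by force
    have m0: "a m x0 < 0"
    proof (rule ccontr)
      assume "\<not> a m x0 < 0"
      then have "c x0 \<ge> 0" using x0 by (intro insert.prems(3)) auto
      then show False using x0 by simp
    qed
    \<comment> \<open>\<open>a'\<close> and \<open>c'\<close> are \<open>a\<close> and
      \<open>c\<close> composed with the projection along \<open>x0\<close> onto the kernel of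
      \<open>a m\<close>; the point \<open>y\<close> below is that projection of
      \<open>x\<close>.\<close>
    define a' where "a' i x = a i x - (a i x0 / a m x0) * a m x" for i x
    define c' where "c' x = c x - (c x0 / a m x0) * a m x" for x
    have "\<exists>\<mu>. (\<forall>i\<in>I. \<mu> i \<ge> 0) \<and> (\<forall>x\<in>U. c' x = (\<Sum>i\<in>I. \<mu> i * a' i x))"
    proof (rule insert.IH)
      show "functional_on U (a' i)" if "i \<in> I" for i
        unfolding a'_def using insert.prems(1) that by (intro functional_on_lincomb) auto
      show "functional_on U c'"
        unfolding c'_def using insert.prems by (intro functional_on_lincomb) auto
      fix x assume x: "x \<in> U" "\<And>i. i \<in> I \<Longrightarrow> a' i x \<ge> 0"
      define y where "y = x - (a m x / a m x0) *\<^sub>R x0"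
      have y: "y \<in> U" unfolding y_def using assms(1) x x0 by (intro subspace_diff subspace_scale)
      have fy: "f y = f x - (f x0 / a m x0) * a m x" if "functional_on U f" for f
        unfolding y_def using functional_on_diff[OF assms(1) that x(1) subspace_scale[OF assms(1) x0(1)]]
          that x0(1) by (simp add: functional_on_def)
      have "c y \<ge> 0"
      proof (rule insert.prems(3)[OF y])
        fix i assume i: "i \<in> insert m I"
        show "a i y \<ge> 0"
        proof (cases "i = m")
          case True
          then show ?thesis using fy[of "a m"] insert.prems(1)[of m] m0 by simp
        next
          case False
          then show ?thesis using fy[of "a i"] insert.prems(1)[of i] x(2)[of i] i by (simp add: a'_def)
        qed
      qed
      then show "c' x \<ge> 0" using fy[of c] insert.prems(2) by (simp add: c'_def)
    qed
    then obtain \<mu> where \<mu>: "\<forall>i\<in>I. \<mu> i \<ge> 0" "\<forall>x\<in>U. c' x = (\<Sum>i\<in>I. \<mu> i * a' i x)" by blast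
    \<comment> \<open>Forced by evaluating at \<open>x0\<close>, where all projected functionals
      vanish. It is nonnegative because the numerator and \<open>a m x0\<close> are both
      negative.\<close>
    define r where "r = (c x0 - (\<Sum>i\<in>I. \<mu> i * a i x0)) / a m x0"
    have "(\<Sum>i\<in>I. \<mu> i * a i x0) \<ge> 0" using \<mu>(1) x0(2) by (intro sum_nonneg) auto
    then have "r \<ge> 0" unfolding r_def using x0(3) m0 by (intro divide_nonpos_neg) auto
    have "c x = (\<Sum>i\<in>I. \<mu> i * a i x) + r * a m x" if "x \<in> U" for x
    proof -
      have "(\<Sum>i\<in>I. \<mu> i * a' i x) = (\<Sum>i\<in>I. \<mu> i * a i x - (\<mu> i * a i x0) * (a m x / a m x0))"
        by (intro sum.cong) (auto simp: a'_def algebra_simps)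
      also have "\<dots> = (\<Sum>i\<in>I. \<mu> i * a i x) - (\<Sum>i\<in>I. \<mu> i * a i x0) * (a m x / a m x0)"
        by (simp only: sum_subtractf sum_distrib_right)
      finally have "c x = (\<Sum>i\<in>I. \<mu> i * a i x) - (\<Sum>i\<in>I. \<mu> i * a i x0) * (a m x / a m x0)
          + c x0 / a m x0 * a m x"
        using bspec[OF \<mu>(2) that] unfolding c'_def by linarith
      then show ?thesis by (simp add: r_def diff_divide_distrib left_diff_distrib)
    qed
    moreover have "(\<Sum>i\<in>I. (\<mu>(m := r)) i * a i x) = (\<Sum>i\<in>I. \<mu> i * a i x)" for x
      using insert.hyps by (intro sum.cong) auto
    ultimately show ?thesis
      using insert.hyps \<mu>(1) \<open>r \<ge> 0\<close> by (intro exI[of _ "\<mu>(m := r)"]) (simp add: add.commute)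
  qed
qed

text \<open>Weights are indexed by \<open>F\<close> rather than by the image, so two labels with the
  same point cause no trouble and injectivity need not be shown.\<close>

lemma convex_hull_finite_image:
  assumes "finite F"
  shows "convex hull (f ` F) = {(\<Sum>x\<in>F. u x *\<^sub>R f x) | u. (\<forall>x\<in>F. 0 \<le> u x) \<and> sum u F = (1::real)}"
    (is "_ = ?H")
proof
  show "convex hull (f ` F) \<subseteq> ?H"
  proof (rule hull_minimal)
    show "f ` F \<subseteq> ?H"
    proof
      fix y assume "y \<in> f ` F"
      then obtain x where x: "x \<in> F" "y = f x" by blast
      have "(\<Sum>z\<in>F. (if z = x then 1 else 0) *\<^sub>R f z) = (\<Sum>z\<in>F. if z = x then f z else 0)"
        by (intro sum.cong) auto
      then show "y \<in> ?H"
        using x assms by (auto intro!: exI[of _ "\<lambda>z. if z = x then 1 else 0"])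
    qed
    show "convex ?H"
    proof (rule convexI)
      fix y z and s t :: real
      assume st: "0 \<le> s" "0 \<le> t" "s + t = 1" and "y \<in> ?H" "z \<in> ?H"
      then obtain u v where u: "\<forall>x\<in>F. 0 \<le> u x" "sum u F = 1" "y = (\<Sum>x\<in>F. u x *\<^sub>R f x)"
        and v: "\<forall>x\<in>F. 0 \<le> v x" "sum v F = 1" "z = (\<Sum>x\<in>F. v x *\<^sub>R f x)" by blast
      have "s *\<^sub>R y + t *\<^sub>R z = (\<Sum>x\<in>F. (s * u x + t * v x) *\<^sub>R f x)"
        by (simp add: u v scaleR_sum_right scaleR_add_left sum.distrib)
      moreover have "(\<Sum>x\<in>F. s * u x + t * v x) = 1"
        using u(2) v(2) st(3) by (simp only: sum.distrib sum_distrib_left[symmetric] mult_1_right)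
      ultimately show "s *\<^sub>R y + t *\<^sub>R z \<in> ?H"
        using u v st by (intro CollectI exI[of _ "\<lambda>x. s * u x + t * v x"]) auto
    qed
  qed
  show "?H \<subseteq> convex hull (f ` F)"
  proof clarify
    fix u :: "_ \<Rightarrow> real" assume "\<forall>x\<in>F. 0 \<le> u x" "sum u F = 1"
    then show "(\<Sum>x\<in>F. u x *\<^sub>R f x) \<in> convex hull (f ` F)"
      by (intro convex_sum[OF assms convex_convex_hull]) (auto intro: hull_inc)
  qed
qed

lemma sum_fun_apply: "(\<Sum>x\<in>A. f x) z = (\<Sum>x\<in>A. f x z)"
  by (induction A rule: infinite_finite_induct) auto

lemma scaleR_fun_apply: "(r *\<^sub>R f) z = r *\<^sub>R f z"
  by (simp add: scaleR_fun_def)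

lemma subspace_kin_K: "subspace (kin_K n)"
proof -
  have "mandelstam S (x + y) = mandelstam S x + mandelstam S y" for S x y
    by (simp add: mandelstam_def split_def sum.distrib)
  moreover have "mandelstam S (r *\<^sub>R x) = r * mandelstam S x" for S r x
    by (simp add: mandelstam_def split_def scaleR_fun_apply sum_distrib_left)
  moreover have "mandelstam S 0 = 0" for S
    by (simp add: mandelstam_def split_def)
  ultimately show ?thesis
    by (auto simp: subspace_def kin_K_def kin_V_def scaleR_fun_apply)
qed

lemma functional_covector: "functional_on (kin_K n) (covector n S)"
  unfolding functional_on_def covector_def
  using subspace_kin_K[of n]
  by (simp add: subspace_add subspace_scale scaleR_fun_apply sum.distrib distrib_left
      algebra_simps flip: sum_distrib_left)

lemma assoc_dir_subset: "assoc_dir n \<alpha> \<subseteq> kin_K n"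
  by (auto simp: assoc_H_def)

lemma subspace_assoc_dir: "subspace (assoc_dir n \<alpha>)"
  using subspace_kin_K[of n] by (auto simp: subspace_def assoc_H_def scaleR_fun_apply)

lemma functional_dual_space: "Y \<in> dual_space U \<Longrightarrow> functional_on U Y"
  by (auto simp: dual_space_def functional_on_def)

lemma functional_covector_dir: "functional_on (assoc_dir n \<alpha>) (covector n S)"
  using functional_covector[of n S] assoc_dir_subset[of n \<alpha>] unfolding functional_on_def by blast

section \<open>Consecutive sets of one ordering and their covectors\<close>

locale ordered_kinematics =
  fixes n :: nat and \<alpha> :: "nat \<Rightarrow> nat"
  assumes n: "n \<ge> 4" and ordering: "is_ordering n \<alpha>"
begin

lemma inj_segment: "1 \<le> i \<Longrightarrow> j \<le> n \<Longrightarrow> inj_on \<alpha> {i..<j}"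
  using ordering_bij(1)[OF ordering] by (rule inj_on_subset) auto

text \<open>Half-open blocks, with \<open>j\<close> one more than the last position
  \<open>a + k\<close>, fit the splitting of sums and trees. The size bound \<open>n - 2\<close>
  excludes just the block of all \<open>n - 1\<close> positions.\<close>

lemma consecutive_iff:
  "S \<in> consecutive n \<alpha> \<longleftrightarrow>
    (\<exists>i j. 1 \<le> i \<and> Suc i < j \<and> j \<le> n \<and> \<not> (i = 1 \<and> j = n) \<and> S = \<alpha> ` {i..<j})"
proof
  assume "S \<in> consecutive n \<alpha>"
  then obtain a k where *: "0 < a" "0 < k" "a + k \<le> n - 1" "S = \<alpha> ` {a..<Suc (a + k)}" "card S \<le> n - 2"
    by (auto simp: consecutive_def atLeastLessThanSuc_atLeastAtMost)
  moreover have "card S = Suc k"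
    using * inj_segment[of a "Suc (a + k)"] n by (simp add: card_image)
  ultimately show "\<exists>i j. 1 \<le> i \<and> Suc i < j \<and> j \<le> n \<and> \<not> (i = 1 \<and> j = n) \<and> S = \<alpha> ` {i..<j}"
    using n by (intro exI[of _ a] exI[of _ "Suc (a + k)"]) auto
next
  assume "\<exists>i j. 1 \<le> i \<and> Suc i < j \<and> j \<le> n \<and> \<not> (i = 1 \<and> j = n) \<and> S = \<alpha> ` {i..<j}"
  then obtain i j where *: "1 \<le> i" "Suc i < j" "j \<le> n" "\<not> (i = 1 \<and> j = n)" "S = \<alpha> ` {i..<j}" by blast
  then have "card S = j - i" using inj_segment[of i j] by (simp add: card_image)
  moreover have "S = \<alpha> ` {i..i + (j - 1 - i)}"
  proof -
    have "{i..<j} = {i..i + (j - 1 - i)}" using * by auto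
    then show ?thesis using * by simp
  qed
  moreover have "0 < i" "0 < j - 1 - i" "i + (j - 1 - i) \<le> n - 1" "2 \<le> j - i" "j - i \<le> n - 2"
    using *(1-4) n by linarith+
  ultimately show "S \<in> consecutive n \<alpha>"
    unfolding consecutive_def mem_Collect_eq by metis
qed

lemma consecutive_eq_segments: "consecutive n \<alpha> = segments \<alpha> 1 n - {{1..n-1}}"
proof -
  have "\<alpha> ` {i..<j} = {1..n-1} \<longleftrightarrow> i = 1 \<and> j = n" if "1 \<le> i" "Suc i < j" "j \<le> n" for i j
    using image_interval_eq_iff[OF ordering_bij(1)[OF ordering], of i j 1 n] that n
    unfolding ordering_bij(2)[OF ordering] by simp
  then show ?thesis
    unfolding segments_def by (intro set_eqI) (simp add: consecutive_iff, metis)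
qed

lemma finite_consecutive: "finite (consecutive n \<alpha>)"
proof (rule finite_subset)
  show "consecutive n \<alpha> \<subseteq> Pow (\<alpha> ` {1..<n})"
    by (auto simp: consecutive_iff)
qed simp

lemma covector_interval:
  "Z \<in> kin_K n \<Longrightarrow> 1 \<le> i \<Longrightarrow> j \<le> n \<Longrightarrow>
    covector n (\<alpha> ` {i..<j}) Z = - pair_sum (\<lambda>u v. Z (\<alpha> u) (\<alpha> v)) i j"
  using covector_segment inj_segment by blast

lemma covector_full:
  assumes "Z \<in> kin_K n"
  shows "covector n (\<alpha> ` {1..<n}) Z = 0"
  unfolding ordering_bij(2)[OF ordering]
  using assms covector_mandelstam[OF assms, of "{1..n-1}"] by (simp add: kin_K_def)

text \<open>Linear independence of the covectors of one ordering, in the form used later: the planar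
  variable of \<open>S\<close> is set to 1 and all others to 0.\<close>

lemma consecutive_dual_basis:
  assumes "S \<in> consecutive n \<alpha>"
  obtains Z where "Z \<in> kin_K n"
    "\<And>T. T \<in> consecutive n \<alpha> \<Longrightarrow> covector n T Z = (if T = S then 1 else 0)"
proof -
  obtain i j where S: "1 \<le> i" "Suc i < j" "j \<le> n" "\<not> (i = 1 \<and> j = n)" "S = \<alpha> ` {i..<j}"
    using assms by (auto simp: consecutive_iff)
  define X :: "nat \<Rightarrow> nat \<Rightarrow> real" where "X k l = (if k = i \<and> l = j then 1 else 0)" for k l
  have X: "l \<le> Suc k \<Longrightarrow> X k l = 0" "X 1 n = 0" "n \<ge> 1" for k l
    using S n by (auto simp: X_def)
  obtain Z where Z: "Z \<in> kin_K n"
    "\<And>k l. 1 \<le> k \<Longrightarrow> k \<le> l \<Longrightarrow> l \<le> n \<Longrightarrow> covector n (\<alpha> ` {k..<l}) Z = X k l"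
    using kinematic_point_planar[where X = X, OF ordering X(3,1,2)] by blast
  have "covector n T Z = (if T = S then 1 else 0)" if T: "T \<in> consecutive n \<alpha>" for T
  proof -
    obtain k l where "1 \<le> k" "Suc k < l" "l \<le> n" "T = \<alpha> ` {k..<l}"
      using T by (auto simp: consecutive_iff)
    then show ?thesis
      using Z(2)[of k l] image_interval_eq_iff[OF ordering_bij(1)[OF ordering], of k l i j] S by (auto simp: X_def)
  qed
  with Z(1) that show thesis by blast
qed

end

section \<open>Faces of the dual associahedron\<close>

lemma in_dual_vertex:
  "z \<in> assoc_dir n \<alpha> \<Longrightarrow> dual_vertex n \<alpha> p S z = covector n S z / covector n S p"
  "z \<notin> assoc_dir n \<alpha> \<Longrightarrow> dual_vertex n \<alpha> p S z = 0"
  by (auto simp: dual_vertex_def)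

lemma small_perturbation:
  assumes "finite I" "\<And>i. i \<in> I \<Longrightarrow> a i > (0::real)"
  obtains e where "e > 0" "\<And>i. i \<in> I \<Longrightarrow> a i + e * b i \<ge> 0"
proof -
  have "\<forall>\<^sub>F e in at_right 0. a i + e * b i > 0" if "i \<in> I" for i
  proof -
    have "((\<lambda>e. a i + e * b i) \<longlongrightarrow> a i + 0 * b i) (at_right 0)"
      by (intro tendsto_intros)
    then show ?thesis using assms(2)[OF that] by (simp add: order_tendstoD(1))
  qed
  then have "\<forall>\<^sub>F e in at_right 0. \<forall>i\<in>I. a i + e * b i > 0"
    using assms(1) by (simp add: eventually_ball_finite)
  then have "\<forall>\<^sub>F e in at_right 0. 0 < e \<and> (\<forall>i\<in>I. a i + e * b i > 0)"
    using eventually_at_right_less[of "0::real"] by eventually_elim auto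
  then obtain e where "0 < e" "\<forall>i\<in>I. a i + e * b i > 0"
    using eventually_happens'[OF trivial_limit_at_right_real] by blast
  with that show thesis by (meson less_imp_le)
qed

locale associahedron_data = ordered_kinematics +
  fixes c :: "nat \<Rightarrow> nat \<Rightarrow> real" and p :: kin
  assumes constants: "assoc_constants n c" and interior: "p \<in> assoc_interior n \<alpha> c"
begin

abbreviation A :: "kin set" where "A \<equiv> associahedron n \<alpha> c"
abbreviation H :: "kin set" where "H \<equiv> assoc_H n \<alpha> c"
abbreviation V :: "kin set" where "V \<equiv> assoc_dir n \<alpha>"
abbreviation W :: "nat set \<Rightarrow> kin \<Rightarrow> real" where "W \<equiv> covector n"
abbreviation A' :: "(kin \<Rightarrow> real) set" where "A' \<equiv> dual_assoc n \<alpha> c p"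

lemma c_pos: "1 \<le> i \<Longrightarrow> Suc i < j \<Longrightarrow> j < n \<Longrightarrow> c i j > 0"
  using constants by (simp add: assoc_constants_def)

lemma H_kin: "Z \<in> H \<Longrightarrow> Z \<in> kin_K n"
  by (simp add: assoc_H_def)

lemma V_kin: "z \<in> V \<Longrightarrow> z \<in> kin_K n"
  by (simp add: assoc_H_def)

lemma p_H: "p \<in> H"
  using interior by (simp add: assoc_interior_def)

lemma W_p: "S \<in> consecutive n \<alpha> \<Longrightarrow> W S p > 0"
  using interior by (simp add: assoc_interior_def)

lemma A_H: "Z \<in> A \<Longrightarrow> Z \<in> H"
  by (simp add: associahedron_def)

lemma W_A: "Z \<in> A \<Longrightarrow> S \<in> consecutive n \<alpha> \<Longrightarrow> W S Z \<ge> 0"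
  by (simp add: associahedron_def assoc_C_def)

lemma A_I: "Z \<in> H \<Longrightarrow> (\<And>S. S \<in> consecutive n \<alpha> \<Longrightarrow> W S Z \<ge> 0) \<Longrightarrow> Z \<in> A"
  using H_kin by (simp add: associahedron_def assoc_C_def)

lemma p_A: "p \<in> A"
  using p_H W_p by (intro A_I) (auto intro: less_imp_le)

lemma diff_V: "Z \<in> H \<Longrightarrow> Z' \<in> H \<Longrightarrow> Z - Z' \<in> V"
  using subspace_diff[OF subspace_kin_K] by (auto simp: assoc_H_def)

lemma add_H: "Z \<in> H \<Longrightarrow> z \<in> V \<Longrightarrow> Z + z \<in> H"
  using subspace_add[OF subspace_kin_K] by (auto simp: assoc_H_def)

lemma W_diff: "Z \<in> H \<Longrightarrow> Z' \<in> H \<Longrightarrow> W S (Z - Z') = W S Z - W S Z'"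
  using functional_on_diff[OF subspace_kin_K functional_covector] H_kin by blast

text \<open>The blocks that label no facet, single positions and the block of all leaves but
  \<open>n\<close>, have value 0. They can occur as intersection or union of crossing sets.\<close>

lemma W_nonneg_interval:
  assumes "Z \<in> A" "1 \<le> i" "i < j" "j \<le> n"
  shows "W (\<alpha> ` {i..<j}) Z \<ge> 0"
proof -
  have K: "Z \<in> kin_K n" using assms A_H H_kin by blast
  consider "j = Suc i" | "i = 1" "j = n" | "Suc i < j" "\<not> (i = 1 \<and> j = n)" using assms by linarith
  then show ?thesis
  proof cases
    case 1
    then show ?thesis
      using covector_interval[OF K assms(2,4)] pair_sum_trivial[of j i] by simp
  next
    case 2
    then show ?thesis using covector_full[OF K] by simp
  next
    case 3
    then have "\<alpha> ` {i..<j} \<in> consecutive n \<alpha>" unfolding consecutive_iff using assms by blast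
    then show ?thesis by (rule W_A[OF assms(1)])
  qed
qed

lemma dual_assoc_dual_space: "Y \<in> A' \<Longrightarrow> Y \<in> dual_space V"
  by (simp add: dual_assoc_def)

lemma dual_assoc_functional: "Y \<in> A' \<Longrightarrow> functional_on V Y"
  by (rule functional_dual_space[OF dual_assoc_dual_space])

lemma dual_assoc_I:
  assumes "functional_on V Y" "\<And>z. z \<notin> V \<Longrightarrow> Y z = 0" "\<And>Z. Z \<in> A \<Longrightarrow> Y (Z - p) \<ge> -1"
  shows "Y \<in> A'"
  using assms by (auto simp: dual_assoc_def dual_space_def functional_on_def)

lemma zero_dual_assoc: "0 \<in> A'"
  by (rule dual_assoc_I) (auto simp: functional_on_def)

lemma convex_dual_assoc: "convex A'"
proof (rule convexI)
  fix x y :: "kin \<Rightarrow> real" and u v :: real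
  assume *: "x \<in> A'" "y \<in> A'" "0 \<le> u" "0 \<le> v" "u + v = 1"
  show "u *\<^sub>R x + v *\<^sub>R y \<in> A'"
  proof (rule dual_assoc_I)
    show "functional_on V (u *\<^sub>R x + v *\<^sub>R y)"
      using dual_assoc_functional[OF *(1)] dual_assoc_functional[OF *(2)]
      by (simp add: functional_on_def scaleR_fun_apply algebra_simps)
    show "(u *\<^sub>R x + v *\<^sub>R y) z = 0" if "z \<notin> V" for z
      using * that by (simp add: scaleR_fun_apply dual_assoc_def dual_space_def)
    fix Z assume "Z \<in> A"
    then have "x (Z - p) \<ge> -1" "y (Z - p) \<ge> -1" using * by (auto simp: dual_assoc_def)
    then have "u * x (Z - p) + v * y (Z - p) \<ge> u * (-1) + v * (-1)"
      using * by (intro add_mono mult_left_mono) auto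
    then show "(u *\<^sub>R x + v *\<^sub>R y) (Z - p) \<ge> -1"
      using *(5) by (simp add: scaleR_fun_apply)
  qed
qed

lemma dual_vertex_dual_assoc:
  assumes "S \<in> consecutive n \<alpha>"
  shows "dual_vertex n \<alpha> p S \<in> A'"
proof (rule dual_assoc_I)
  show "functional_on V (dual_vertex n \<alpha> p S)"
    using functional_covector_dir[of n \<alpha> S] subspace_assoc_dir[of n \<alpha>]
    by (simp add: functional_on_def in_dual_vertex subspace_add subspace_scale add_divide_distrib)
  fix Z assume "Z \<in> A"
  then show "dual_vertex n \<alpha> p S (Z - p) \<ge> -1"
    using W_A[of Z, OF _ assms] W_p[OF assms] W_diff[OF A_H[of Z] p_H, of S] diff_V[OF A_H[of Z] p_H]
    by (simp add: in_dual_vertex pos_le_divide_eq)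
qed (simp add: in_dual_vertex)

text \<open>The vertex of the associahedron that belongs to a tree: the constants at non-adjacent
  positions, the heights of \<open>vertex_heights\<close> at adjacent ones. That the root clade has
  sum 0 is the hyperplane equation.\<close>

lemma associahedron_vertex:
  assumes "drawn_with g (map \<alpha> [1..<n])"
  obtains Z where "Z \<in> H"
    "\<And>S. S \<in> consecutive n \<alpha> \<Longrightarrow> if S \<in> clades g then W S Z = 0 else W S Z > 0"
proof -
  obtain h where h: "\<And>i j. 1 \<le> i \<Longrightarrow> Suc i < j \<Longrightarrow> j \<le> n \<Longrightarrow>
    (if \<alpha> ` {i..<j} \<in> clades g then pair_sum (\<lambda>u v. if v = Suc u then h u else c u v) i j = 0
     else pair_sum (\<lambda>u v. if v = Suc u then h u else c u v) i j < 0)"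
    using vertex_heights[OF assms ordering_bij(1)[OF ordering], of c] c_pos by blast
  let ?s = "\<lambda>u v. if v = Suc u then h u else c u v"
  have "\<alpha> ` {1..<n} \<in> clades g" using full_clade[OF assms] n by simp
  then have "pair_sum ?s 1 n = 0" using h[of 1 n] n by simp
  then obtain Z where Z: "Z \<in> kin_K n" "\<And>u v. 1 \<le> u \<Longrightarrow> u < v \<Longrightarrow> v < n \<Longrightarrow> Z (\<alpha> u) (\<alpha> v) = ?s u v"
    using kinematic_point[OF ordering] by blast
  show thesis
  proof (rule that)
    show "Z \<in> H" unfolding assoc_H_def using Z by auto
    fix S assume "S \<in> consecutive n \<alpha>"
    then obtain i j where S: "1 \<le> i" "Suc i < j" "j \<le> n" "S = \<alpha> ` {i..<j}"
      unfolding consecutive_iff by blast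
    have "pair_sum (\<lambda>u v. Z (\<alpha> u) (\<alpha> v)) i j = pair_sum ?s i j"
      using S by (intro pair_sum_cong Z(2)) auto
    then show "if S \<in> clades g then W S Z = 0 else W S Z > 0"
      using h[of i j] S covector_interval[OF Z(1), of i j] by simp
  qed
qed

lemma dual_vertex_hull_apply:
  assumes "finite F" "Y \<in> convex hull (dual_vertex n \<alpha> p ` F)"
  obtains u where "\<forall>S\<in>F. 0 \<le> u S" "sum u F = 1" "\<And>z. Y z = (\<Sum>S\<in>F. u S * dual_vertex n \<alpha> p S z)"
  using assms by (auto simp: convex_hull_finite_image sum_fun_apply scaleR_fun_apply)

text \<open>Evaluation at \<open>Z0 - p\<close>, with \<open>Z0\<close> the vertex of the tree, is
  at least -1 on the dual polytope and exposes the face. That only the hull of \<open>F\<close>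
  attains -1 is Farkas at \<open>Z0\<close>: near \<open>Z0\<close> the associahedron is cut out by
  the covectors in \<open>F\<close> alone, so a \<open>Y\<close> that is minimal there is a
  nonnegative combination of them.\<close>

lemma clades_dual_face:
  assumes g: "drawn_with g (map \<alpha> [1..<n])"
  shows "clades g - {{1..n-1}} \<in> dual_faces n \<alpha> c p"
proof -
  define F where "F = clades g - {{1..n-1}}"
  have F: "F \<subseteq> consecutive n \<alpha>"
    using clades_drawn_segments[OF g] by (auto simp: F_def consecutive_eq_segments)
  have fin: "finite F" using F finite_consecutive by (rule finite_subset)
  have FI: "S \<in> F \<longleftrightarrow> S \<in> clades g" if "S \<in> consecutive n \<alpha>" for S
    using that by (auto simp: F_def consecutive_eq_segments)
  obtain Z0 where Z0: "Z0 \<in> H"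
    "\<And>S. S \<in> consecutive n \<alpha> \<Longrightarrow> if S \<in> clades g then W S Z0 = 0 else W S Z0 > 0"
    using associahedron_vertex[OF g] by blast
  have W0: "W S Z0 = 0" if "S \<in> F" for S using Z0(2)[of S] FI[of S] that F by auto
  have W1: "W S Z0 > 0" if "S \<in> consecutive n \<alpha> - F" for S using Z0(2)[of S] FI[of S] that by auto
  have Z0A: "Z0 \<in> A"
  proof (rule A_I[OF Z0(1)])
    show "W S Z0 \<ge> 0" if "S \<in> consecutive n \<alpha>" for S
      using Z0(2)[OF that] by (simp split: if_splits)
  qed
  have d0: "Z0 - p \<in> V" using diff_V[OF Z0(1) p_H] .
  let ?T = "convex hull (dual_vertex n \<alpha> p ` F)"
  have val: "Y (Z0 - p) = -1" if "Y \<in> ?T" for Y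
  proof -
    obtain u where u: "sum u F = 1" "\<And>z. Y z = (\<Sum>S\<in>F. u S * dual_vertex n \<alpha> p S z)"
      using dual_vertex_hull_apply[OF fin \<open>Y \<in> ?T\<close>] by blast
    have "(\<Sum>S\<in>F. u S * dual_vertex n \<alpha> p S (Z0 - p)) = (\<Sum>S\<in>F. - u S)"
    proof (intro sum.cong refl)
      fix S assume "S \<in> F"
      then have "W S p > 0" using W_p F by blast
      then show "u S * dual_vertex n \<alpha> p S (Z0 - p) = - u S"
        using W0[OF \<open>S \<in> F\<close>] d0 W_diff[OF Z0(1) p_H] by (simp add: in_dual_vertex)
    qed
    then show ?thesis using u by (simp add: sum_negf)
  qed
  have hull: "Y \<in> ?T" if Y: "Y \<in> A'" "Y (Z0 - p) = -1" for Y
  proof -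
    note fY = dual_assoc_functional[OF Y(1)]
    have "\<exists>\<mu>. (\<forall>S\<in>F. \<mu> S \<ge> 0) \<and> (\<forall>z\<in>V. Y z = (\<Sum>S\<in>F. \<mu> S * W S z))"
    proof (rule farkas[OF subspace_assoc_dir fin functional_covector_dir fY])
      fix z assume z: "z \<in> V" "\<And>S. S \<in> F \<Longrightarrow> 0 \<le> W S z"
      obtain e where e: "e > 0" "\<And>S. S \<in> consecutive n \<alpha> - F \<Longrightarrow> W S Z0 + e * W S z \<ge> 0"
        using small_perturbation[of "consecutive n \<alpha> - F" "\<lambda>S. W S Z0" "\<lambda>S. W S z"]
          finite_consecutive W1 by blast
      have ez: "e *\<^sub>R z \<in> V" using subspace_scale[OF subspace_assoc_dir z(1)] .
      have "Z0 + e *\<^sub>R z \<in> A"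
      proof (rule A_I[OF add_H[OF Z0(1) ez]])
        fix S assume S: "S \<in> consecutive n \<alpha>"
        have "W S (Z0 + e *\<^sub>R z) = W S Z0 + e * W S z"
          using functional_covector[of n S] H_kin[OF Z0(1)] V_kin[OF z(1)] V_kin[OF ez]
          by (simp add: functional_on_def)
        then show "W S (Z0 + e *\<^sub>R z) \<ge> 0"
          using e S z(2)[of S] W0[of S] by (cases "S \<in> F") auto
      qed
      then have "Y (Z0 + e *\<^sub>R z - p) \<ge> -1" using Y(1) by (simp add: dual_assoc_def)
      moreover have "Z0 + e *\<^sub>R z - p = (Z0 - p) + e *\<^sub>R z" by simp
      moreover have "Y ((Z0 - p) + e *\<^sub>R z) = Y (Z0 - p) + e * Y z"
        using fY d0 z(1) ez by (simp add: functional_on_def)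
      ultimately have "e * Y z \<ge> 0" using Y(2) by simp
      then show "Y z \<ge> 0" using e(1) by (simp add: zero_le_mult_iff)
    qed
    then obtain \<mu> where \<mu>: "\<And>S. S \<in> F \<Longrightarrow> \<mu> S \<ge> 0" "\<And>z. z \<in> V \<Longrightarrow> Y z = (\<Sum>S\<in>F. \<mu> S * W S z)"
      by blast
    \<comment> \<open>\<open>dual_vertex\<close> divides by \<open>W S p\<close>, and
      \<open>W S (Z0 - p) = - W S p\<close> for \<open>S\<close> in \<open>F\<close>; hence the
      rescaled weights sum to 1.\<close>
    define u where "u S = \<mu> S * W S p" for S
    have "Y (Z0 - p) = (\<Sum>S\<in>F. - u S)"
      unfolding \<mu>(2)[OF d0] u_def using W0 W_diff[OF Z0(1) p_H] by (intro sum.cong) auto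
    then have "sum u F = 1" using Y(2) by (simp add: sum_negf)
    moreover have "\<forall>S\<in>F. 0 \<le> u S" using \<mu>(1) W_p F by (force simp: u_def)
    moreover have "Y = (\<Sum>S\<in>F. u S *\<^sub>R dual_vertex n \<alpha> p S)"
    proof
      fix z
      show "Y z = (\<Sum>S\<in>F. u S *\<^sub>R dual_vertex n \<alpha> p S) z"
      proof (cases "z \<in> V")
        case True
        have "u S * dual_vertex n \<alpha> p S z = \<mu> S * W S z" if "S \<in> F" for S
          using W_p[of S] that F True by (auto simp: u_def in_dual_vertex)
        then show ?thesis using \<mu>(2)[OF True] by (simp add: sum_fun_apply scaleR_fun_apply)
      next
        case False
        then show ?thesis
          using dual_assoc_dual_space[OF Y(1)]
          by (simp add: sum_fun_apply scaleR_fun_apply in_dual_vertex dual_space_def)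
      qed
    qed
    ultimately show ?thesis unfolding convex_hull_finite_image[OF fin] by blast
  qed
  have sub: "?T \<subseteq> A'"
    using F dual_vertex_dual_assoc by (intro hull_minimal convex_dual_assoc) auto
  have "?T face_of A'"
    unfolding face_of_def
  proof (intro conjI ballI impI)
    fix a b x assume ab: "a \<in> A'" "b \<in> A'" "x \<in> ?T" "x \<in> open_segment a b"
    then obtain u where u: "0 < u" "u < 1" "x = (1 - u) *\<^sub>R a + u *\<^sub>R b" by (auto simp: in_segment)
    have "-1 = (1 - u) * a (Z0 - p) + u * b (Z0 - p)"
      using val[OF ab(3)] u(3) by (simp add: scaleR_fun_apply)
    moreover have ge: "a (Z0 - p) \<ge> -1" "b (Z0 - p) \<ge> -1"
      using ab Z0A by (auto simp: dual_assoc_def)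
    ultimately have "(1 - u) * (a (Z0 - p) + 1) + u * (b (Z0 - p) + 1) = 0"
      by (simp add: algebra_simps)
    moreover have "(1 - u) * (a (Z0 - p) + 1) \<ge> 0" "u * (b (Z0 - p) + 1) \<ge> 0"
      using u ge by auto
    ultimately have "(1 - u) * (a (Z0 - p) + 1) = 0" "u * (b (Z0 - p) + 1) = 0"
      by linarith+
    then show "a \<in> ?T" "b \<in> ?T" using hull[OF ab(1)] hull[OF ab(2)] u by auto
  qed (use sub in auto)
  moreover have "0 \<notin> ?T" using val[of 0] by auto
  then have "?T \<noteq> A'" using zero_dual_assoc by metis
  ultimately show ?thesis unfolding F_def[symmetric] dual_faces_def using F by blast
qed

text \<open>The hyperplane equation makes the values at adjacent pairs add up to the total of the
  constants; being nonnegative, each is at most that total.\<close>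

lemma adjacent_bounded:
  obtains M where "\<And>Z i. Z \<in> A \<Longrightarrow> 1 \<le> i \<Longrightarrow> Suc i < n \<Longrightarrow> W (\<alpha> ` {i..<i + 2}) Z \<le> M"
proof
  fix Z i assume Z: "Z \<in> A" and i: "1 \<le> i" "Suc i < n"
  have K: "Z \<in> kin_K n" by (rule H_kin[OF A_H[OF Z]])
  let ?s = "\<lambda>u v. Z (\<alpha> u) (\<alpha> v)"
  have adj: "W (\<alpha> ` {u..<u + 2}) Z = - ?s u (Suc u)" if "1 \<le> u" "Suc u < n" for u
  proof -
    have "pair_sum ?s u (u + 2) = ?s u (Suc u)"
      using pair_sum_split[of u "Suc u" "u + 2" ?s] by (simp add: pair_sum_trivial)
    then show ?thesis using covector_interval[OF K, of u "u + 2"] that by simp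
  qed
  have row: "(\<Sum>v\<in>{Suc u..<n}. ?s u v)
      = (if Suc u < n then ?s u (Suc u) else 0) + (\<Sum>v\<in>{Suc (Suc u)..<n}. c u v)" if "1 \<le> u" for u
  proof -
    have "(\<Sum>v\<in>{Suc u..<n}. ?s u v)
      = (if Suc u < n then ?s u (Suc u) else 0) + (\<Sum>v\<in>{Suc (Suc u)..<n}. ?s u v)"
      by (simp add: sum.atLeast_Suc_lessThan)
    also have "(\<Sum>v\<in>{Suc (Suc u)..<n}. ?s u v) = (\<Sum>v\<in>{Suc (Suc u)..<n}. c u v)"
      using A_H[OF Z] that by (intro sum.cong) (auto simp: assoc_H_def)
    finally show ?thesis .
  qed
  have neg: "(\<Sum>u\<in>{1..<n}. if Suc u < n then - ?s u (Suc u) else 0)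
      = - (\<Sum>u\<in>{1..<n}. if Suc u < n then ?s u (Suc u) else 0)"
    unfolding sum_negf[symmetric] by (intro sum.cong) auto
  have "0 = pair_sum ?s 1 n"
    using covector_full[OF K] covector_interval[OF K, of 1 n] by simp
  also have "\<dots> = (\<Sum>u\<in>{1..<n}. if Suc u < n then ?s u (Suc u) else 0) + (\<Sum>u\<in>{1..<n}. \<Sum>v\<in>{Suc (Suc u)..<n}. c u v)"
    unfolding pair_sum_def by (simp add: row flip: sum.distrib)
  finally have "(\<Sum>u\<in>{1..<n}. if Suc u < n then - ?s u (Suc u) else 0)
      = (\<Sum>u\<in>{1..<n}. \<Sum>v\<in>{Suc (Suc u)..<n}. c u v)"
    using neg by linarith
  moreover have "- ?s u (Suc u) \<ge> 0" if "1 \<le> u" "Suc u < n" for u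
    using W_nonneg_interval[OF Z, of u "u + 2"] adj[OF that] that by simp
  then have "(if Suc i < n then - ?s i (Suc i) else 0) \<le> (\<Sum>u\<in>{1..<n}. if Suc u < n then - ?s u (Suc u) else 0)"
    using i by (intro member_le_sum[of i "{1..<n}" "\<lambda>u. if Suc u < n then - ?s u (Suc u) else 0"]) auto
  ultimately show "W (\<alpha> ` {i..<i + 2}) Z \<le> (\<Sum>u\<in>{1..<n}. \<Sum>v\<in>{Suc (Suc u)..<n}. c u v)"
    using adj[OF i] i by simp
qed

text \<open>The origin is an interior point of the dual polytope because the associahedron is bounded.\<close>

lemma dual_assoc_reflect:
  assumes "Y \<in> A'"
  obtains e where "e > 0" "- e *\<^sub>R Y \<in> A'"
proof -
  \<comment> \<open>Both signs of every adjacent covector are listed: the Farkas hypothesis then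
    forces the adjacent entries of \<open>z\<close> to vanish, the others vanish because
    \<open>z\<close> is a direction, and so every \<open>Y\<close> is representable.\<close>
  define I where "I = {True, False} \<times> {i. 1 \<le> i \<and> Suc i < n}"
  define a where "a q z = (if fst q then 1 else -1) * W (\<alpha> ` {snd q..<snd q + 2}) z" for q z
  have fY: "functional_on V Y" by (rule dual_assoc_functional[OF assms])
  have "finite {i. 1 \<le> i \<and> Suc i < n}" by (rule finite_subset[of _ "{..n}"]) auto
  then have fin: "finite I" by (simp add: I_def)
  have "\<exists>\<mu>. (\<forall>q\<in>I. \<mu> q \<ge> 0) \<and> (\<forall>z\<in>V. Y z = (\<Sum>q\<in>I. \<mu> q * a q z))"
  proof (rule farkas[OF subspace_assoc_dir fin _ fY])
    show "functional_on V (a q)" for q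
      using functional_covector_dir[of n \<alpha> "\<alpha> ` {snd q..<snd q + 2}"]
      by (auto simp: a_def functional_on_def algebra_simps)
    fix z assume z: "z \<in> V" "\<And>q. q \<in> I \<Longrightarrow> a q z \<ge> 0"
    have K: "z \<in> kin_K n" by (rule V_kin[OF z(1)])
    let ?s = "\<lambda>u v. z (\<alpha> u) (\<alpha> v)"
    have "?s u v = 0" if "1 \<le> u" "u < v" "v < n" for u v
    proof (cases "v = Suc u")
      case True
      have "pair_sum ?s u (u + 2) = ?s u (Suc u)"
        using pair_sum_split[of u "Suc u" "u + 2" ?s] by (simp add: pair_sum_trivial)
      moreover have "a (True, u) z \<ge> 0" "a (False, u) z \<ge> 0"
        using z(2) that by (auto simp: I_def)
      ultimately show ?thesis
        using covector_interval[OF K, of u "u + 2"] True that by (simp add: a_def)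
    next
      case False
      then show ?thesis using z(1) that by (simp add: assoc_H_def)
    qed
    then have s: "?s u v = 0" if "1 \<le> u" "u < n" "1 \<le> v" "v < n" for u v
      using that kin_K_symmetric[OF K] by (metis nat_neq_iff)
    have "z x y = 0" for x y
    proof (cases "x \<in> {1..n-1} \<and> y \<in> {1..n-1}")
      case True
      then obtain u v where "x = \<alpha> u" "y = \<alpha> v" "1 \<le> u" "u < n" "1 \<le> v" "v < n"
        unfolding ordering_bij(2)[OF ordering, symmetric] by auto
      then show ?thesis using s by simp
    next
      case False
      then show ?thesis using K kin_K_symmetric(1)[OF K, of x y] by (auto simp: kin_K_def kin_V_def)
    qed
    then have "z = 0" by (intro ext) simp
    then have "Y z = Y (0 *\<^sub>R z)" by simp
    also have "\<dots> = 0" using fY z(1) unfolding functional_on_def by (metis mult_zero_left)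
    finally show "Y z \<ge> 0" by simp
  qed
  then obtain \<mu> where \<mu>: "\<And>q. q \<in> I \<Longrightarrow> \<mu> q \<ge> 0" "\<And>z. z \<in> V \<Longrightarrow> Y z = (\<Sum>q\<in>I. \<mu> q * a q z)"
    by blast
  obtain M where M: "\<And>Z i. Z \<in> A \<Longrightarrow> 1 \<le> i \<Longrightarrow> Suc i < n \<Longrightarrow> W (\<alpha> ` {i..<i + 2}) Z \<le> M"
    using adjacent_bounded by blast
  \<comment> \<open>On \<open>A\<close>, and so at \<open>p\<close> too, the adjacent covectors take
    values between 0 and \<open>M\<close>; either sign of a difference is therefore at most
    \<open>M\<close>.\<close>
  define B where "B = (\<Sum>q\<in>I. \<mu> q * M)"
  have "M \<ge> 0"
    using M[OF p_A, of 1] W_nonneg_interval[OF p_A, of 1 "1 + 2"] n by simp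
  then have B: "B \<ge> 0" unfolding B_def using \<mu>(1) by (intro sum_nonneg mult_nonneg_nonneg)
  have YB: "Y (Z - p) \<le> B" if Z: "Z \<in> A" for Z
  proof -
    have "a q (Z - p) \<le> M" if q: "q \<in> I" for q
    proof -
      obtain b i where qi: "q = (b, i)" "1 \<le> i" "Suc i < n" using q by (auto simp: I_def)
      then show ?thesis
        using W_nonneg_interval[OF p_A, of i "i + 2"] W_nonneg_interval[OF Z, of i "i + 2"]
          M[OF Z, of i] M[OF p_A, of i] W_diff[OF A_H[OF Z] p_H, of "\<alpha> ` {i..<i + 2}"]
        by (cases b) (simp_all add: a_def)
    qed
    then show ?thesis
      unfolding \<mu>(2)[OF diff_V[OF A_H[OF Z] p_H]] B_def using \<mu>(1)
      by (intro sum_mono mult_left_mono)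
  qed
  show thesis
  proof (rule that[of "1 / (B + 1)"])
    show "- (1 / (B + 1)) *\<^sub>R Y \<in> A'"
    proof (rule dual_assoc_I)
      show "functional_on V (- (1 / (B + 1)) *\<^sub>R Y)"
        using fY by (simp add: functional_on_def scaleR_fun_apply algebra_simps add_divide_distrib diff_divide_distrib)
      show "(- (1 / (B + 1)) *\<^sub>R Y) z = 0" if "z \<notin> V" for z
        using dual_assoc_dual_space[OF assms] that by (simp add: scaleR_fun_apply dual_space_def)
      fix Z assume "Z \<in> A"
      then have "Y (Z - p) \<le> B + 1" using YB[of Z] by simp
      then have "Y (Z - p) / (B + 1) \<le> 1" using B by simp
      then show "(- (1 / (B + 1)) *\<^sub>R Y) (Z - p) \<ge> -1"
        by (simp add: scaleR_fun_apply)
    qed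
  qed (use B in simp)
qed

text \<open>Some negative multiple of each \<open>Y\<close> also lies in the polytope, so for
  nonzero \<open>Y\<close> the origin is inside a segment starting at \<open>Y\<close>, and a face
  that contains the origin contains \<open>Y\<close>.\<close>

lemma face_containing_zero:
  assumes "T face_of A'" "0 \<in> T"
  shows "T = A'"
proof
  show "T \<subseteq> A'" by (rule face_of_imp_subset[OF assms(1)])
  show "A' \<subseteq> T"
  proof
    fix Y assume Y: "Y \<in> A'"
    obtain e where e: "e > 0" "- e *\<^sub>R Y \<in> A'" using dual_assoc_reflect[OF Y] by blast
    show "Y \<in> T"
    proof (cases "Y = 0")
      case False
      \<comment> \<open>Solves \<open>1 - u = u * e\<close>, which places the origin on the
        segment.\<close>
      define u where "u = 1 / (1 + e)"
      have u: "0 < u" "u < 1" using e(1) by (auto simp: u_def)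
      have "1 - u - u * e = 0" using e(1) by (simp add: u_def field_simps)
      then have "(1 - u) *\<^sub>R Y + u *\<^sub>R (- e *\<^sub>R Y) = 0"
        by (simp flip: scaleR_left_diff_distrib)
      moreover have "Y \<noteq> - e *\<^sub>R Y"
      proof
        assume "Y = - e *\<^sub>R Y"
        then have "(1 + e) *\<^sub>R Y = 0" by (simp add: scaleR_left_distrib eq_neg_iff_add_eq_0)
        then show False using e(1) False by simp
      qed
      ultimately have "0 \<in> open_segment Y (- e *\<^sub>R Y)"
        using u by (auto simp: in_segment intro!: exI[of _ u])
      then show ?thesis using assms Y e(2) unfolding face_of_def by blast
    qed (use assms in simp)
  qed
qed

text \<open>Union and intersection count the pairs of leaves as often as the two crossing blocks do,
  except the pairs between the two outer parts, which only the union contains. Those are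
  non-adjacent, hence constant on the plane.\<close>

lemma crossing_relation:
  assumes "Z \<in> kin_K n" "1 \<le> i" "i < k" "k < j" "j < l" "l \<le> n"
  shows "W (\<alpha> ` {i..<j}) Z + W (\<alpha> ` {k..<l}) Z = W (\<alpha> ` {i..<l}) Z + W (\<alpha> ` {k..<j}) Z
    + (\<Sum>u\<in>{i..<k}. \<Sum>v\<in>{j..<l}. Z (\<alpha> u) (\<alpha> v))"
proof -
  let ?s = "\<lambda>u v. Z (\<alpha> u) (\<alpha> v)"
  have "(\<Sum>u\<in>{i..<k}. \<Sum>v\<in>{k..<l}. ?s u v)
      = (\<Sum>u\<in>{i..<k}. (\<Sum>v\<in>{k..<j}. ?s u v) + (\<Sum>v\<in>{j..<l}. ?s u v))"
    using assms by (intro sum.cong refl) (simp add: sum.atLeastLessThan_concat)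
  then show ?thesis
    using pair_sum_split[of i k l ?s] pair_sum_split[of i k j ?s] assms
    by (simp add: covector_interval[OF assms(1)] sum.distrib)
qed

text \<open>If two facets of the associahedron cross, then in the dual polytope the segment between
  their vertices meets, by the relation above, a segment ending in the interior point \<open>0\<close>.\<close>

lemma dual_face_not_crossing:
  assumes F: "F \<in> dual_faces n \<alpha> c p" and "\<alpha> ` {i..<j} \<in> F" "\<alpha> ` {k..<l} \<in> F"
    and ij: "1 \<le> i" "i < k" "k < j" "j < l" "l \<le> n"
  shows False
proof -
  let ?S = "\<alpha> ` {i..<j}" and ?T = "\<alpha> ` {k..<l}" and ?U = "\<alpha> ` {i..<l}" and ?R = "\<alpha> ` {k..<j}"
  let ?F = "convex hull (dual_vertex n \<alpha> p ` F)"
  have face: "?F face_of A'" "?F \<noteq> A'" and cons: "?S \<in> consecutive n \<alpha>" "?T \<in> consecutive n \<alpha>"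
    using F assms(2,3) by (auto simp: dual_faces_def)
  define \<kappa> where "\<kappa> = (\<Sum>u\<in>{i..<k}. \<Sum>v\<in>{j..<l}. c u v)"
  have "\<kappa> > 0"
    unfolding \<kappa>_def using ij by (intro sum_pos) (auto intro!: c_pos)
  have rel: "W ?S Z + W ?T Z = W ?U Z + W ?R Z + \<kappa>" if "Z \<in> H" for Z
  proof -
    have "(\<Sum>u\<in>{i..<k}. \<Sum>v\<in>{j..<l}. Z (\<alpha> u) (\<alpha> v)) = \<kappa>"
      unfolding \<kappa>_def using that ij by (intro sum.cong refl) (auto simp: assoc_H_def)
    then show ?thesis using crossing_relation[OF H_kin[OF that] ij] by simp
  qed
  have rel0: "W ?S z + W ?T z = W ?U z + W ?R z" if "z \<in> V" for z
  proof -
    have "(\<Sum>u\<in>{i..<k}. \<Sum>v\<in>{j..<l}. z (\<alpha> u) (\<alpha> v)) = 0"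
      using that ij by (intro sum.neutral ballI) (auto simp: assoc_H_def)
    then show ?thesis using crossing_relation[OF V_kin[OF that] ij] by simp
  qed
  define q where "q = W ?S p + W ?T p"
  have q: "q > 0" unfolding q_def using W_p[OF cons(1)] W_p[OF cons(2)] by simp
  \<comment> \<open>The weights cancel the denominators of the dual vertices, so that on directions
    \<open>x\<close> is \<open>(W ?S + W ?T) / q\<close>.\<close>
  define x where "x = (W ?S p / q) *\<^sub>R dual_vertex n \<alpha> p ?S + (W ?T p / q) *\<^sub>R dual_vertex n \<alpha> p ?T"
  have "W ?S p / q + W ?T p / q = 1" using q by (simp add: q_def flip: add_divide_distrib)
  then have xF: "x \<in> ?F"
    unfolding x_def using assms(2,3) W_p[OF cons(1)] W_p[OF cons(2)] q
    by (intro convexD[OF convex_convex_hull]) (auto intro: hull_inc)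
  then have xA: "x \<in> A'" using face_of_imp_subset[OF face(1)] by blast
  have x: "x z = (W ?U z + W ?R z) / q" if "z \<in> V" for z
    using W_p[OF cons(1)] W_p[OF cons(2)] rel0[OF that] that
    by (simp add: x_def scaleR_fun_apply in_dual_vertex flip: add_divide_distrib)
  \<comment> \<open>With \<open>t = \<kappa> / q\<close>, the values of \<open>x\<close> at
    \<open>Z - p\<close> are at least \<open>-(1 - t)\<close>, and
    \<open>(1 + t) * (1 - t) \<le> 1\<close> leaves room to stretch \<open>x\<close> by
    \<open>1 + t\<close>.\<close>
  define r where "r = 1 + \<kappa> / q"
  have r: "r > 1" using \<open>\<kappa> > 0\<close> q by (simp add: r_def)
  have rx: "r *\<^sub>R x \<in> A'"
  proof (rule dual_assoc_I)
    show "functional_on V (r *\<^sub>R x)"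
      using dual_assoc_functional[OF xA] by (simp add: functional_on_def scaleR_fun_apply algebra_simps)
    show "(r *\<^sub>R x) z = 0" if "z \<notin> V" for z
      using dual_assoc_dual_space[OF xA] that by (simp add: scaleR_fun_apply dual_space_def)
    fix Z assume Z: "Z \<in> A"
    have "W ?U Z \<ge> 0" "W ?R Z \<ge> 0" using W_nonneg_interval[OF Z] ij by auto
    then have "W ?U (Z - p) + W ?R (Z - p) \<ge> - (q - \<kappa>)"
      using W_diff[OF A_H[OF Z] p_H] rel[OF p_H] by (simp add: q_def)
    then have "x (Z - p) \<ge> - (q - \<kappa>) / q"
      unfolding x[OF diff_V[OF A_H[OF Z] p_H]] using q by (intro divide_right_mono) auto
    then have "r * x (Z - p) \<ge> r * (- (q - \<kappa>) / q)" using r by (intro mult_left_mono) auto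
    moreover have "r * (- (q - \<kappa>) / q) = (\<kappa> / q)\<^sup>2 - 1"
      using q by (simp add: r_def field_simps power2_eq_square)
    moreover have "(\<kappa> / q)\<^sup>2 \<ge> 0" by simp
    ultimately have "r * x (Z - p) \<ge> -1" by linarith
    then show "(r *\<^sub>R x) (Z - p) \<ge> -1" by (simp add: scaleR_fun_apply)
  qed
  have "0 \<in> ?F"
  proof (cases "x = 0")
    case False
    have "x = (1 - (1 - 1 / r)) *\<^sub>R (r *\<^sub>R x) + (1 - 1 / r) *\<^sub>R 0" using r by simp
    moreover have "r *\<^sub>R x \<noteq> 0" using r False by simp
    ultimately have "x \<in> open_segment (r *\<^sub>R x) 0"
      unfolding in_segment using r by (intro conjI exI[of _ "1 - 1 / r"]) auto
    then show ?thesis using face(1) rx zero_dual_assoc xF unfolding face_of_def by blast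
  qed (use xF in simp)
  then show False using face_containing_zero[OF face(1)] face(2) by simp
qed

lemma dual_face_laminar:
  assumes F: "F \<in> dual_faces n \<alpha> c p"
  shows "laminar F"
  unfolding laminar_def
proof (intro ballI)
  fix S T assume ST: "S \<in> F" "T \<in> F"
  have "F \<subseteq> consecutive n \<alpha>" using F by (simp add: dual_faces_def)
  then obtain i j k l where S: "S = \<alpha> ` {i..<j}" "1 \<le> i" "Suc i < j" "j \<le> n"
    and T: "T = \<alpha> ` {k..<l}" "1 \<le> k" "Suc k < l" "l \<le> n"
    using ST unfolding consecutive_iff subset_eq by meson
  have "\<not> (i < k \<and> k < j \<and> j < l)"
    using dual_face_not_crossing[OF F, of i j k l] ST S T by blast
  moreover have "\<not> (k < i \<and> i < l \<and> l < j)"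
    using dual_face_not_crossing[OF F, of k l i j] ST S T by blast
  ultimately consider "j \<le> k" | "l \<le> i" | "k \<le> i" "j \<le> l" | "i \<le> k" "l \<le> j" by linarith
  then show "S \<subseteq> T \<or> T \<subseteq> S \<or> S \<inter> T = {}"
  proof cases
    case 1
    have "\<alpha> ` {i..<j} \<inter> \<alpha> ` {k..<l} = \<alpha> ` ({i..<j} \<inter> {k..<l})"
      using S T by (intro inj_on_image_Int[OF ordering_bij(1)[OF ordering], symmetric]) auto
    then show ?thesis using 1 S T by auto
  next
    case 2
    have "\<alpha> ` {i..<j} \<inter> \<alpha> ` {k..<l} = \<alpha> ` ({i..<j} \<inter> {k..<l})"
      using S T by (intro inj_on_image_Int[OF ordering_bij(1)[OF ordering], symmetric]) auto
    then show ?thesis using 2 S T by auto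
  next
    case 3
    then have "S \<subseteq> T" unfolding S T by (intro image_mono) auto
    then show ?thesis by blast
  next
    case 4
    then have "T \<subseteq> S" unfolding S T by (intro image_mono) auto
    then show ?thesis by blast
  qed
qed

end

section \<open>Laminar families of consecutive sets and planar trees\<close>

context ordered_kinematics
begin

lemma drawn_labelled: "drawn_with g (map \<alpha> [1..<n]) \<Longrightarrow> labelled_by {1..n-1} g"
  using drawn_with_labelled_by[of g "map \<alpha> [1..<n]"] ordering_bij[OF ordering]
  by (simp add: distinct_map)

lemma full_mem_clades: "drawn_with g (map \<alpha> [1..<n]) \<Longrightarrow> {1..n-1} \<in> clades g"
  using full_clade[of g \<alpha> 1 n] n ordering_bij(2)[OF ordering] by simp

lemma card_proper_clades:
  assumes "drawn_with g (map \<alpha> [1..<n])"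
  shows "finite (clades g - {{1..n-1}})" "card (clades g - {{1..n-1}}) = n - 3"
proof -
  have fin: "finite (clades g)"
    using finite_vertices[OF drawn_labelled[OF assms]] by (simp add: clades_def)
  then show "finite (clades g - {{1..n-1}})" by simp
  show "card (clades g - {{1..n-1}}) = n - 3"
    using card_clades[OF drawn_labelled[OF assms]] full_mem_clades[OF assms] fin n by simp
qed

lemma laminar_consecutive_extend:
  assumes "F \<subseteq> consecutive n \<alpha>" "laminar F"
  obtains g where "drawn_with g (map \<alpha> [1..<n])" "F \<subseteq> clades g - {{1..n-1}}"
proof -
  have "F \<subseteq> segments \<alpha> 1 n" "{1..n-1} \<notin> F" using assms(1) by (auto simp: consecutive_eq_segments)
  then show thesis
    using laminar_segments_extend[OF _ ordering_bij(1)[OF ordering] _ assms(2)] n that by fastforce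
qed

lemma maximal_laminar:
  assumes "drawn_with g (map \<alpha> [1..<n])" "F \<subseteq> consecutive n \<alpha>" "laminar F" "clades g - {{1..n-1}} \<subseteq> F"
  shows "F = clades g - {{1..n-1}}"
proof -
  obtain h where h: "drawn_with h (map \<alpha> [1..<n])" "F \<subseteq> clades h - {{1..n-1}}"
    using laminar_consecutive_extend[OF assms(2,3)] by blast
  have "clades g - {{1..n-1}} = clades h - {{1..n-1}}"
    using card_proper_clades[OF assms(1)] card_proper_clades[OF h(1)] assms(4) h(2)
    by (intro card_subset_eq) auto
  then show ?thesis using assms(4) h(2) by auto
qed

end

context associahedron_data
begin

text \<open>A face is laminar, so it lies in the family of a tree, which is again a face; a facet is
  therefore such a family. Conversely, a tree family cannot grow and stay laminar.\<close>

lemma dual_facets_eq: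
  "dual_facets n \<alpha> c p = {clades g - {{1..n-1}} | g. drawn_with g (map \<alpha> [1..<n])}"
proof
  have faces: "F \<subseteq> consecutive n \<alpha>" "laminar F" if "F \<in> dual_faces n \<alpha> c p" for F
    using that dual_face_laminar by (auto simp: dual_faces_def)
  show "dual_facets n \<alpha> c p \<subseteq> {clades g - {{1..n-1}} | g. drawn_with g (map \<alpha> [1..<n])}"
  proof
    fix F assume F: "F \<in> dual_facets n \<alpha> c p"
    then have "F \<in> dual_faces n \<alpha> c p" by (simp add: dual_facets_def)
    then obtain g where g: "drawn_with g (map \<alpha> [1..<n])" "F \<subseteq> clades g - {{1..n-1}}"
      using laminar_consecutive_extend[OF faces] by blast
    then have "clades g - {{1..n-1}} = F"
      using F clades_dual_face[OF g(1)] by (auto simp: dual_facets_def)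
    then show "F \<in> {clades g - {{1..n-1}} | g. drawn_with g (map \<alpha> [1..<n])}" using g by blast
  qed
  show "{clades g - {{1..n-1}} | g. drawn_with g (map \<alpha> [1..<n])} \<subseteq> dual_facets n \<alpha> c p"
  proof
    fix F assume "F \<in> {clades g - {{1..n-1}} | g. drawn_with g (map \<alpha> [1..<n])}"
    then obtain g where g: "drawn_with g (map \<alpha> [1..<n])" "F = clades g - {{1..n-1}}" by blast
    have "G = F" if "G \<in> dual_faces n \<alpha> c p" "F \<subseteq> G" for G
      using maximal_laminar[OF g(1) faces[OF that(1)]] that(2) g(2) by simp
    then show "F \<in> dual_facets n \<alpha> c p"
      using clades_dual_face[OF g(1)] g(2) by (simp add: dual_facets_def)
  qed
qed

end

section \<open>Uniqueness of laminar combinations\<close>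

text \<open>Formally minus the value of the combination of covectors at the matrix whose only entry
  is s_ij = 1. That matrix is outside K_n, so a covector gives overlaps only up to a common
  constant. For laminar \<open>F\<close> with nonnegative weights this is the similarity belonging
  to an ultrametric.\<close>

definition overlap :: "'a set set \<Rightarrow> ('a set \<Rightarrow> real) \<Rightarrow> 'a \<Rightarrow> 'a \<Rightarrow> real"
  where "overlap F x i j = (\<Sum>T\<in>{T \<in> F. i \<in> T \<and> j \<in> T}. x T)"

text \<open>If some nonempty member lies properly inside \<open>S\<close>, take \<open>i\<close> in
  a maximal one and \<open>j\<close> in the rest of \<open>S\<close>; otherwise \<open>a\<close> and
  \<open>b\<close> do. In tree terms \<open>S\<close> is the least common ancestor of
  \<open>i\<close> and \<open>j\<close>, though \<open>S\<close> need not be in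
  \<open>F\<close>.\<close>

lemma laminar_separated_pair:
  assumes "finite F" "laminar (insert S F)" "a \<in> S" "b \<in> S" "a \<noteq> b"
  obtains i j where "i \<in> S" "j \<in> S" "i \<noteq> j" "\<And>T. T \<in> F \<Longrightarrow> i \<in> T \<Longrightarrow> j \<in> T \<Longrightarrow> S \<subseteq> T"
proof -
  define \<M> where "\<M> = {T \<in> F. T \<subset> S \<and> T \<noteq> {}}"
  have lam: "T \<subseteq> T' \<or> T' \<subseteq> T" if "T \<in> insert S F" "T' \<in> insert S F" "k \<in> T" "k \<in> T'" for T T' k
    using assms(2) that unfolding laminar_def by blast
  show thesis
  proof (cases "\<M> = {}")
    case True
    have "S \<subseteq> T" if "T \<in> F" "a \<in> T" for T
      using lam[of T S a] that assms(3) True by (auto simp: \<M>_def)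
    with assms that show thesis by blast
  next
    case False
    then obtain M where M: "M \<in> \<M>" "\<And>T. T \<in> \<M> \<Longrightarrow> M \<subseteq> T \<Longrightarrow> M = T"
      using finite_has_maximal[of \<M>] assms(1) by (auto simp: \<M>_def)
    then obtain i j where ij: "i \<in> M" "j \<in> S - M" unfolding \<M>_def by blast
    have "S \<subseteq> T" if T: "T \<in> F" "i \<in> T" "j \<in> T" for T
    proof (rule ccontr)
      assume "\<not> S \<subseteq> T"
      then have "T \<in> \<M>" using lam[of T S i] T ij M(1) by (auto simp: \<M>_def)
      moreover have "M \<subseteq> T" using lam[of T M i] T ij M(1) by (auto simp: \<M>_def)
      ultimately show False using M(2) ij T by blast
    qed
    moreover have "i \<in> S" "i \<noteq> j" using ij M(1) by (auto simp: \<M>_def)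
    ultimately show thesis using that[of i j] ij by blast
  qed
qed

text \<open>A laminar family with positive weights is recovered from its overlap function, like a
  tree from its ultrametric: its members are the balls.\<close>

lemma laminar_support:
  assumes F: "finite F" "laminar F" "\<And>T. T \<in> F \<Longrightarrow> 0 \<le> x T"
    and G: "finite G" "laminar G" "\<And>T. T \<in> G \<Longrightarrow> 0 \<le> y T"
    and N: "\<Union>F \<subseteq> N" "\<Union>G \<subseteq> N"
    and eq: "\<And>i j. i \<in> N \<Longrightarrow> j \<in> N \<Longrightarrow> i \<noteq> j \<Longrightarrow> overlap F x i j = overlap G y i j"
    and S: "S \<in> F" "x S > 0" "a \<in> S" "b \<in> S" "a \<noteq> b"
  shows "S \<in> G"
proof -
  have "laminar (insert S F)" using F(2) S(1) by (simp add: insert_absorb)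
  then obtain i j where ij: "i \<in> S" "j \<in> S" "i \<noteq> j" "\<And>T. T \<in> F \<Longrightarrow> i \<in> T \<Longrightarrow> j \<in> T \<Longrightarrow> S \<subseteq> T"
    using laminar_separated_pair[OF F(1) _ S(3-5)] by blast
  have SN: "S \<subseteq> N" using N(1) S(1) by blast
  have lamF: "T \<subseteq> S \<or> S \<subseteq> T" if "T \<in> F" "i \<in> T" for T
    using F(2) that S(1) ij(1) unfolding laminar_def by blast
  have inside: "overlap F x i j \<le> overlap F x i k" if "k \<in> S" for k
    unfolding overlap_def using F ij that by (intro sum_mono2) auto
  have outside: "overlap F x i k < overlap F x i j" if "k \<notin> S" for k
  proof -
    have "overlap F x i k \<le> (\<Sum>T\<in>{T \<in> F. i \<in> T \<and> j \<in> T} - {S}. x T)"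
      unfolding overlap_def using F lamF ij that by (intro sum_mono2) auto
    also have "\<dots> = overlap F x i j - x S"
      unfolding overlap_def using F(1) S(1) ij by (subst sum_diff1) auto
    finally show ?thesis using S(2) by simp
  qed
  have "0 < x S" by (rule S(2))
  also have "x S \<le> overlap F x i j"
    unfolding overlap_def using F S ij by (intro member_le_sum) auto
  finally have pos: "overlap G y i j > 0" using eq[of i j] ij(1-3) SN by (simp add: subset_iff)
  \<comment> \<open>The smallest set of positive weight in \<open>G\<close> around \<open>i\<close>
    and \<open>j\<close> is the candidate for \<open>S\<close>.\<close>
  define P where "P = {T \<in> G. i \<in> T \<and> j \<in> T \<and> y T \<noteq> 0}"
  have finP: "finite P" using G(1) by (simp add: P_def)
  have P: "overlap G y i j = (\<Sum>T\<in>P. y T)"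
    unfolding overlap_def P_def using G(1) by (intro sum.mono_neutral_right) auto
  then have "P \<noteq> {}" using pos by auto
  then obtain T0 where T0: "T0 \<in> P" "\<And>T. T \<in> P \<Longrightarrow> T \<subseteq> T0 \<Longrightarrow> T0 = T"
    using finite_has_minimal[OF finP] by auto
  have T0': "T0 \<in> G" "i \<in> T0" "j \<in> T0" "y T0 > 0" "T0 \<subseteq> N"
    using T0(1) G(3)[of T0] N(2) by (auto simp: P_def)
  have lamG: "T \<subseteq> T0 \<or> T0 \<subseteq> T" if "T \<in> G" "i \<in> T" for T
    using G(2) that T0' unfolding laminar_def by blast
  \<comment> \<open>Every set counted at \<open>(i, j)\<close> contains \<open>T0\<close>, so in
    \<open>G\<close> the overlap does not drop at \<open>k\<close>, against \<open>outside\<close>.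
    In the other direction, leaving \<open>T0\<close> would lose \<open>y T0\<close>, against
    \<open>inside\<close>.\<close>
  have "T0 \<subseteq> S"
  proof (rule ccontr)
    assume "\<not> T0 \<subseteq> S"
    then obtain k where k: "k \<in> T0" "k \<notin> S" by blast
    have "T0 \<subseteq> T" if "T \<in> P" for T
      using lamG[of T] T0(2)[OF that] that unfolding P_def by blast
    then have "P \<subseteq> {T \<in> G. i \<in> T \<and> k \<in> T}" using k by (auto simp: P_def)
    then have "overlap G y i j \<le> overlap G y i k"
      unfolding P unfolding overlap_def using G(1,3) by (intro sum_mono2) auto
    then show False using outside[OF k(2)] eq[of i k] eq[of i j] k ij SN T0'(5) by (metis not_less subsetD)
  qed
  moreover have "S \<subseteq> T0"
  proof (rule ccontr)
    assume "\<not> S \<subseteq> T0"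
    then obtain k where k: "k \<in> S" "k \<notin> T0" by blast
    have "overlap G y i k \<le> (\<Sum>T\<in>{T \<in> G. i \<in> T \<and> j \<in> T} - {T0}. y T)"
      unfolding overlap_def using G(1,3) lamG T0'(3) k by (intro sum_mono2) auto
    also have "\<dots> = overlap G y i j - y T0"
      unfolding overlap_def using G(1) T0' by (subst sum_diff1) auto
    finally have "overlap G y i k < overlap G y i j" using T0'(4) by simp
    then show False using inside[OF k(1)] eq[of i k] eq[of i j] k ij SN T0'(2) by (metis not_less subsetD)
  qed
  ultimately show ?thesis using T0'(1) by simp
qed

text \<open>The symmetric matrix unit of a pair, as a sum of products so that double sums over
  \<open>S\<close> factor. A single one violates the hyperplane equation, a difference of two does
  not.\<close>

definition pair_point :: "nat \<Rightarrow> nat \<Rightarrow> kin"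
  where "pair_point i j u v = of_bool (u = i) * of_bool (v = j) + of_bool (u = j) * of_bool (v = i)"

lemma double_sum_pair_point:
  assumes "finite S"
  shows "(\<Sum>u\<in>S. \<Sum>v\<in>S. pair_point i j u v) = 2 * of_bool (i \<in> S \<and> j \<in> S)"
proof -
  have "(\<Sum>u\<in>S. of_bool (u = k)) = (of_bool (k \<in> S) :: real)" for k
    using assms by (simp add: of_bool_def)
  then show ?thesis
    unfolding pair_point_def sum.distrib sum_product[symmetric] by simp
qed

lemma pair_point_difference:
  assumes "i \<in> {1..n-1}" "j \<in> {1..n-1}" "i \<noteq> j" "k \<in> {1..n-1}" "l \<in> {1..n-1}" "k \<noteq> l"
  shows "pair_point i j - pair_point k l \<in> kin_K n"
    and "finite S \<Longrightarrow> covector n S (pair_point i j - pair_point k l)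
      = of_bool (k \<in> S \<and> l \<in> S) - of_bool (i \<in> S \<and> j \<in> S)"
proof -
  let ?Z = "pair_point i j - pair_point k l"
  have sym: "?Z u v = ?Z v u" and diag: "?Z u u = 0" for u v
    using assms by (auto simp: pair_point_def)
  have sum: "(\<Sum>u\<in>S. \<Sum>v\<in>S. ?Z u v) = 2 * of_bool (i \<in> S \<and> j \<in> S) - 2 * of_bool (k \<in> S \<and> l \<in> S)"
    if "finite S" for S
    using double_sum_pair_point[OF that] by (simp add: sum_subtractf)
  have "2 * mandelstam {1..n-1} ?Z = 0"
    using mandelstam_double_sum[of "{1..n-1}" ?Z] sym diag sum[of "{1..n-1}"] assms by simp
  then show K: "?Z \<in> kin_K n"
    using sym diag assms by (auto simp: kin_K_def kin_V_def pair_point_def)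
  show "covector n S ?Z = of_bool (k \<in> S \<and> l \<in> S) - of_bool (i \<in> S \<and> j \<in> S)" if "finite S"
    using K sum[OF that] by (simp add: covector_def)
qed

lemma sum_of_bool_overlap:
  "finite F \<Longrightarrow> (\<Sum>S\<in>F. x S * of_bool (i \<in> S \<and> j \<in> S)) = overlap F x i j"
  unfolding overlap_def by (simp add: of_bool_def if_distrib sum.inter_filter cong: if_cong)

text \<open>Evaluation at differences of matrix units shows that the two overlaps differ by a
  constant. Both are nonnegative and, as the full set is no member, both vanish at some pair; so the
  constant is 0.\<close>

lemma overlap_covector:
  assumes n: "n \<ge> 3"
    and F: "F \<subseteq> Pow {1..n-1} - {{1..n-1}}" "laminar F" "\<And>T. T \<in> F \<Longrightarrow> 0 \<le> x T"
    and G: "G \<subseteq> Pow {1..n-1} - {{1..n-1}}" "laminar G" "\<And>T. T \<in> G \<Longrightarrow> 0 \<le> y T"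
    and eq: "\<And>Z. Z \<in> kin_K n \<Longrightarrow> (\<Sum>S\<in>F. x S * covector n S Z) = (\<Sum>S\<in>G. y S * covector n S Z)"
    and ij: "i \<in> {1..n-1}" "j \<in> {1..n-1}" "i \<noteq> j"
  shows "overlap F x i j = overlap G y i j"
proof -
  let ?N = "{1..n-1}"
  have fin: "finite F" "finite G"
    using F(1) G(1) by (auto intro: finite_subset[OF _ finite_Pow_iff[THEN iffD2]])
  have diff: "overlap F x k l - overlap F x i j = overlap G y k l - overlap G y i j"
    if "i \<in> ?N" "j \<in> ?N" "i \<noteq> j" "k \<in> ?N" "l \<in> ?N" "k \<noteq> l" for i j k l
  proof -
    have "(\<Sum>S\<in>H. w S * covector n S (pair_point i j - pair_point k l)) = overlap H w k l - overlap H w i j"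
      if "H \<subseteq> Pow ?N - {?N}" "finite H" for H w
    proof -
      have "(\<Sum>S\<in>H. w S * covector n S (pair_point i j - pair_point k l))
          = (\<Sum>S\<in>H. w S * of_bool (k \<in> S \<and> l \<in> S) - w S * of_bool (i \<in> S \<and> j \<in> S))"
      proof (intro sum.cong refl)
        fix S assume "S \<in> H"
        then have "finite S" using \<open>H \<subseteq> _\<close> by (auto intro: finite_subset)
        then show "w S * covector n S (pair_point i j - pair_point k l)
            = w S * of_bool (k \<in> S \<and> l \<in> S) - w S * of_bool (i \<in> S \<and> j \<in> S)"
          using pair_point_difference(2)[OF \<open>i \<in> ?N\<close> \<open>j \<in> ?N\<close> \<open>i \<noteq> j\<close> \<open>k \<in> ?N\<close> \<open>l \<in> ?N\<close> \<open>k \<noteq> l\<close>]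
          by (simp only: right_diff_distrib)
      qed
      then show ?thesis using \<open>finite H\<close> by (simp only: sum_subtractf sum_of_bool_overlap)
    qed
    then show ?thesis
      using eq[OF pair_point_difference(1)[OF that]] F(1) G(1) fin by simp
  qed
  have zero: "\<exists>k l. k \<in> ?N \<and> l \<in> ?N \<and> k \<noteq> l \<and> overlap H w k l = 0"
    if H: "H \<subseteq> Pow ?N - {?N}" "laminar H" "finite H" for H and w :: "nat set \<Rightarrow> real"
  proof -
    have "laminar (insert ?N H)" using H(1,2) unfolding laminar_def by blast
    moreover have "1 \<in> ?N" "2 \<in> ?N" "1 \<noteq> (2::nat)" using n by auto
    ultimately obtain k l where kl: "k \<in> ?N" "l \<in> ?N" "k \<noteq> l" "\<And>T. T \<in> H \<Longrightarrow> k \<in> T \<Longrightarrow> l \<in> T \<Longrightarrow> ?N \<subseteq> T"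
      using laminar_separated_pair[OF H(3)] by blast
    then have "{T \<in> H. k \<in> T \<and> l \<in> T} = {}" using H(1) by blast
    then have "overlap H w k l = 0" by (simp only: overlap_def sum.empty)
    with kl show ?thesis by blast
  qed
  have nonneg: "overlap F x k l \<ge> 0" "overlap G y k l \<ge> 0" for k l
    using F(3) G(3) by (auto simp: overlap_def intro: sum_nonneg)
  obtain k l where kl: "k \<in> ?N" "l \<in> ?N" "k \<noteq> l" "overlap F x k l = 0"
    using zero[OF F(1,2) fin(1)] by blast
  obtain k' l' where kl': "k' \<in> ?N" "l' \<in> ?N" "k' \<noteq> l'" "overlap G y k' l' = 0"
    using zero[OF G(1,2) fin(2)] by blast
  show ?thesis
    using diff[OF ij kl(1-3)] diff[OF ij kl'(1-3)] kl(4) kl'(4) nonneg(1)[of k' l'] nonneg(2)[of k l]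
    by linarith
qed

text \<open>This is the cone over the embedded boundary of the dual associahedron.\<close>

definition fan :: "nat \<Rightarrow> (nat \<Rightarrow> nat) \<Rightarrow> (kin \<Rightarrow> real) set"
  where "fan n \<alpha> = {Y. \<exists>F u. F \<subseteq> consecutive n \<alpha> \<and> laminar F \<and> (\<forall>S\<in>F. 0 \<le> u S)
    \<and> (\<forall>Z. Y Z = (\<Sum>S\<in>F. u S * covector n S Z))}"

lemma facet_point_apply: "facet_point n F x Z = (\<Sum>S\<in>F. x S * covector n S Z)"
  by (simp add: facet_point_def sum_fun_apply scaleR_fun_apply)

lemma fan_scaleR: "Y \<in> fan n \<alpha> \<Longrightarrow> 0 \<le> r \<Longrightarrow> r *\<^sub>R Y \<in> fan n \<alpha>"
proof -
  assume "Y \<in> fan n \<alpha>" "0 \<le> r"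
  then obtain F u where "F \<subseteq> consecutive n \<alpha>" "laminar F" "\<forall>S\<in>F. 0 \<le> u S"
    "\<forall>Z. Y Z = (\<Sum>S\<in>F. u S * covector n S Z)" by (auto simp: fan_def)
  with \<open>0 \<le> r\<close> show ?thesis
    unfolding fan_def
    by (intro CollectI exI[of _ F] exI[of _ "\<lambda>S. r * u S"])
      (simp add: scaleR_fun_apply sum_distrib_left mult.assoc)
qed

context ordered_kinematics
begin

lemma consecutive_subset_Pow: "consecutive n \<alpha> \<subseteq> Pow {1..n-1} - {{1..n-1}}"
proof -
  have "S \<subseteq> {1..n-1}" if "S \<in> segments \<alpha> 1 n" for S
  proof -
    have "S \<subseteq> \<alpha> ` {1..<n}" using that by (auto simp: segments_def)
    then show ?thesis unfolding ordering_bij(2)[OF ordering] .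
  qed
  then show ?thesis unfolding consecutive_eq_segments by blast
qed

text \<open>The point dual to \<open>S\<close> reads off the coefficient of \<open>S\<close> in both
  representations of the same covector; the one from the fan is nonnegative or absent.\<close>

lemma fan_coordinates_nonneg:
  assumes "F \<subseteq> consecutive n \<alpha>" "facet_point n F x \<in> fan n \<alpha>" "S \<in> F"
  shows "x S \<ge> 0"
proof -
  obtain G u where G: "G \<subseteq> consecutive n \<alpha>" "\<forall>S\<in>G. 0 \<le> u S"
    "\<And>Z. facet_point n F x Z = (\<Sum>S\<in>G. u S * covector n S Z)"
    using assms(2) by (auto simp: fan_def)
  have fin: "finite F" "finite G"
    using assms(1) G(1) finite_consecutive by (auto intro: finite_subset)
  obtain Z where Z: "\<And>T. T \<in> consecutive n \<alpha> \<Longrightarrow> covector n T Z = (if T = S then 1 else 0)"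
    using consecutive_dual_basis[of S] assms(1,3) by blast
  have "(\<Sum>T\<in>H. w T * covector n T Z) = (\<Sum>T\<in>H. if T = S then w T else 0)"
    if "H \<subseteq> consecutive n \<alpha>" for H w
    using that by (intro sum.cong refl) (simp add: Z subsetD)
  then have "(\<Sum>T\<in>F. if T = S then x T else 0) = (\<Sum>T\<in>G. if T = S then u T else 0)"
    using G(1,3) assms(1) by (metis facet_point_apply)
  then have "x S = (if S \<in> G then u S else 0)" using fin assms(3) by simp
  then show ?thesis using G(2) by simp
qed

lemma positive_fan_support:
  assumes "F \<subseteq> Pow {1..n-1} - {{1..n-1}}" "laminar F" "\<And>S. S \<in> F \<Longrightarrow> x S > 0 \<and> card S \<ge> 2"
    and "facet_point n F x \<in> fan n \<alpha>"
  shows "F \<subseteq> consecutive n \<alpha>"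
proof
  fix S assume S: "S \<in> F"
  obtain G u where G: "G \<subseteq> consecutive n \<alpha>" "laminar G" "\<And>S. S \<in> G \<Longrightarrow> 0 \<le> u S"
    "\<And>Z. facet_point n F x Z = (\<Sum>S\<in>G. u S * covector n S Z)"
    using assms(4) by (auto simp: fan_def)
  have G': "G \<subseteq> Pow {1..n-1} - {{1..n-1}}" using G(1) consecutive_subset_Pow by blast
  have fin: "finite F" "finite G"
    using assms(1) G' by (auto intro: finite_subset[OF _ finite_Pow_iff[THEN iffD2]])
  have x: "T \<in> F \<Longrightarrow> 0 \<le> x T" for T using assms(3) by (simp add: less_imp_le)
  have eq: "overlap F x i j = overlap G u i j" if "i \<in> {1..n-1}" "j \<in> {1..n-1}" "i \<noteq> j" for i j
    using n that G(4) by (intro overlap_covector[OF _ assms(1,2) x G' G(2,3)]) (auto simp: facet_point_apply)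
  have "finite S" "\<not> card S \<le> Suc 0"
    using assms(3)[OF S] by (auto intro: card_ge_0_finite)
  then obtain a b where ab: "a \<in> S" "b \<in> S" "a \<noteq> b"
    by (auto simp: card_le_Suc0_iff_eq)
  have N: "\<Union>F \<subseteq> {1..n-1}" "\<Union>G \<subseteq> {1..n-1}" using assms(1) G' by blast+
  have "x S > 0" using assms(3)[OF S] by simp
  from laminar_support[OF fin(1) assms(2) x fin(2) G(2,3) N eq S this ab] have "S \<in> G" .
  then show "S \<in> consecutive n \<alpha>" using G(1) by blast
qed

end

context associahedron_data
begin

lemma dual_boundary_subset_fan: "dual_boundary n \<alpha> c p \<subseteq> fan n \<alpha>"
proof
  fix Y assume "Y \<in> dual_boundary n \<alpha> c p"
  then obtain F where F: "F \<in> dual_faces n \<alpha> c p" "Y \<in> convex hull (covector n ` F)"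
    by (auto simp: dual_boundary_def)
  have sub: "F \<subseteq> consecutive n \<alpha>" using F(1) by (simp add: dual_faces_def)
  then have "finite F" using finite_consecutive by (rule finite_subset)
  then obtain u where "\<forall>S\<in>F. 0 \<le> u S" "Y = (\<Sum>S\<in>F. u S *\<^sub>R covector n S)"
    using F(2) by (auto simp: convex_hull_finite_image)
  then show "Y \<in> fan n \<alpha>"
    unfolding fan_def using sub dual_face_laminar[OF F(1)]
    by (intro CollectI exI[of _ F] exI[of _ u]) (simp add: sum_fun_apply scaleR_fun_apply)
qed

end

section \<open>Integration over orthants\<close>

lemma exp_half_line_integral:
  fixes w :: real
  assumes "w > 0"
  shows "has_bochner_integral lborel (\<lambda>t. indicator {0..} t * exp (- (t * w))) (1 / w)"
proof (rule has_bochner_integral_nn_integral)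
  have "((\<lambda>t. - exp (- (t * w)) / w) \<longlongrightarrow> - 0 / w) at_top"
    using assms by (intro tendsto_intros filterlim_compose[OF exp_at_bot] filterlim_compose[OF filterlim_uminus_at_bot_at_top]
        filterlim_at_top_mult_tendsto_pos[OF tendsto_const _ filterlim_ident]) auto
  then have "(\<integral>\<^sup>+t. ennreal (exp (- (t * w))) * indicator {0..} t \<partial>lborel) = - 0 / w - (- exp (- (0 * w)) / w)"
    using assms by (intro nn_integral_FTC_atLeast) (auto intro!: derivative_eq_intros)
  also have "(\<integral>\<^sup>+t. ennreal (exp (- (t * w))) * indicator {0..} t \<partial>lborel)
      = (\<integral>\<^sup>+t. ennreal (indicator {0..} t * exp (- (t * w))) \<partial>lborel)"
    by (intro nn_integral_cong) (simp split: split_indicator)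
  finally show "(\<integral>\<^sup>+t. ennreal (indicator {0..} t * exp (- (t * w))) \<partial>lborel) = ennreal (1 / w)" by simp
qed (use assms in auto)

lemma exp_orthant_integral:
  fixes w :: "'i \<Rightarrow> real"
  assumes "finite F" "\<And>i. i \<in> F \<Longrightarrow> w i > 0"
  shows "(LINT x | Pi\<^sub>M F (\<lambda>_. lborel). of_bool (\<forall>i\<in>F. 0 \<le> x i) * exp (- (\<Sum>i\<in>F. x i * w i)))
    = (\<Prod>i\<in>F. 1 / w i)"
proof -
  interpret product_sigma_finite "\<lambda>_::'i. lborel :: real measure" ..
  have "of_bool (\<forall>i\<in>F. 0 \<le> x i) * exp (- (\<Sum>i\<in>F. x i * w i))
      = (\<Prod>i\<in>F. indicator {0..} (x i) * exp (- (x i * w i)))" for x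
  proof (cases "\<forall>i\<in>F. 0 \<le> x i")
    case True
    then have "(\<Prod>i\<in>F. indicator {0..} (x i) * exp (- (x i * w i))) = (\<Prod>i\<in>F. exp (- (x i * w i)))"
      by (intro prod.cong) auto
    then show ?thesis using True assms(1) by (simp add: exp_sum flip: sum_negf)
  next
    case False
    then obtain i where "i \<in> F" "\<not> 0 \<le> x i" by blast
    then have "\<exists>i\<in>F. indicator {0..} (x i) * exp (- (x i * w i)) = 0" by (intro bexI[of _ i]) auto
    then show ?thesis using False assms(1) by (simp add: prod_zero)
  qed
  moreover have "has_bochner_integral lborel (\<lambda>t. indicator {0..} t * exp (- (t * w i))) (1 / w i)"
    if "i \<in> F" for i
    using exp_half_line_integral assms(2) that by blast
  ultimately show ?thesis
    using product_integral_prod[OF assms(1), of "\<lambda>i t. indicator {0..} t * exp (- (t * w i))"]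
    by (simp add: has_bochner_integral_iff)
qed

text \<open>Each coordinate hyperplane is a box with one side of length 0. This discards the points
  of the cone on lower-dimensional faces.\<close>

lemma AE_PiM_lborel_nonzero:
  fixes F :: "'i set"
  assumes "finite F"
  shows "AE x in Pi\<^sub>M F (\<lambda>_. lborel). \<forall>i\<in>F. x i \<noteq> (0::real)"
proof -
  interpret product_sigma_finite "\<lambda>_::'i. lborel :: real measure" ..
  have "AE x in Pi\<^sub>M F (\<lambda>_. lborel). x i \<noteq> (0::real)" if i: "i \<in> F" for i
  proof (rule AE_I)
    let ?B = "Pi\<^sub>E F (\<lambda>j. if j = i then {0::real} else UNIV)"
    show "{x \<in> space (Pi\<^sub>M F (\<lambda>_. lborel)). \<not> x i \<noteq> (0::real)} \<subseteq> ?B"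
      by (auto simp: space_PiM PiE_iff extensional_def)
    show "?B \<in> sets (Pi\<^sub>M F (\<lambda>_. lborel))"
      using assms by (intro sets_PiM_I_finite) auto
    have "emeasure (Pi\<^sub>M F (\<lambda>_. lborel)) ?B = (\<Prod>j\<in>F. emeasure lborel (if j = i then {0::real} else UNIV))"
      using assms by (intro emeasure_PiM) auto
    also have "\<dots> = 0" using assms i by (intro prod_zero bexI[of _ i]) auto
    finally show "emeasure (Pi\<^sub>M F (\<lambda>_. lborel)) ?B = 0" .
  qed
  then show ?thesis using assms by (simp add: AE_finite_all)
qed

text \<open>The root vertex is the end of the edge towards the unwritten leaf \<open>n\<close>,
  which is external; hence its clade \<open>A\<close> is removed.\<close>

lemma internal_edges_drawn:
  assumes "labelled_by A g" "card A \<ge> 2"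
  shows "inj_on leaf_labels (internal_edges g)" "leaf_labels ` internal_edges g = clades g - {A}"
proof -
  have sub: "internal_edges g \<subseteq> vertices g" by (auto simp: internal_edges_def vertices_def)
  then show "inj_on leaf_labels (internal_edges g)"
    by (rule inj_on_subset[OF inj_on_leaf_labels_vertices[OF assms(1)]])
  from assms(1) show "leaf_labels ` internal_edges g = clades g - {A}"
  proof cases
    case (1 i)
    then show ?thesis using assms(2) by simp
  next
    case (2 B l C r)
    have "leaf_labels ` internal_edges g = clades l \<union> clades r"
      using 2 by (simp add: internal_edges_Vertex clades_def image_Un)
    moreover have "clades g = insert A (clades l \<union> clades r)"
      using 2 by (simp add: labelled_by_leaf_labels)
    moreover have "A \<notin> clades l" "A \<notin> clades r"
      using clades_disjoint[OF 2(3,4,5)] 2(1) by simp_all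
    ultimately show ?thesis by blast
  qed
qed

context associahedron_data
begin

lemma covector_facet_boundary:
  assumes "F \<in> dual_faces n \<alpha> c p" "\<forall>S\<in>F. 0 \<le> u S" "sum u F = 1"
  shows "(\<Sum>S\<in>F. u S *\<^sub>R covector n S) \<in> dual_boundary n \<alpha> c p"
proof -
  have "finite F"
    using assms(1) finite_consecutive by (auto simp: dual_faces_def intro: finite_subset)
  then have "(\<Sum>S\<in>F. u S *\<^sub>R covector n S) \<in> convex hull (covector n ` F)"
    using assms(2,3) by (auto simp: convex_hull_finite_image)
  then show ?thesis using assms(1) by (auto simp: dual_boundary_def)
qed

lemma dual_facet_properties:
  assumes "F \<in> dual_facets n \<alpha> c p"
  shows "F \<subseteq> consecutive n \<alpha>" "laminar F" "finite F" "card F = n - 3" "F \<in> dual_faces n \<alpha> c p"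
proof -
  show face: "F \<in> dual_faces n \<alpha> c p" using assms by (simp add: dual_facets_def)
  then show "F \<subseteq> consecutive n \<alpha>" by (simp add: dual_faces_def)
  show "laminar F" by (rule dual_face_laminar[OF face])
  show "finite F" "card F = n - 3"
    using assms card_proper_clades unfolding dual_facets_eq by auto
qed

lemma dual_facet_I:
  assumes "F \<subseteq> consecutive n \<alpha>" "laminar F" "card F = n - 3"
  shows "F \<in> dual_facets n \<alpha> c p"
proof -
  obtain g where g: "drawn_with g (map \<alpha> [1..<n])" "F \<subseteq> clades g - {{1..n-1}}"
    using laminar_consecutive_extend[OF assms(1,2)] by blast
  then have "F = clades g - {{1..n-1}}"
    using card_proper_clades[OF g(1)] assms(3) by (intro card_subset_eq) auto
  then show ?thesis unfolding dual_facets_eq using g(1) by blast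
qed

lemma finite_dual_facets: "finite (dual_facets n \<alpha> c p)"
proof (rule finite_subset)
  show "dual_facets n \<alpha> c p \<subseteq> Pow (consecutive n \<alpha>)" using dual_facet_properties(1) by blast
qed (use finite_consecutive in simp)

end

lemma consecutive_card: "S \<in> consecutive n \<alpha> \<Longrightarrow> card S \<ge> 2"
  by (simp add: consecutive_def)

section \<open>The cone over the intersection of two boundaries\<close>

locale associahedron_pair =
  a: associahedron_data n \<alpha> c p + b: associahedron_data n \<beta> d q
  for n \<alpha> c p \<beta> d q
begin

definition C :: "(kin \<Rightarrow> real) set"
  where "C = cone hull (dual_boundary n \<alpha> c p \<inter> dual_boundary n \<beta> d q)"

text \<open>The fan is itself a cone and contains the boundary. This bounds \<open>C\<close> from
  above; \<open>common_facet_cone\<close> bounds it from below.\<close>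

lemma C_subset_fan: "C \<subseteq> fan n \<alpha>" "C \<subseteq> fan n \<beta>"
proof -
  have "cone (fan n \<gamma>)" for \<gamma> by (auto simp: cone_def fan_scaleR)
  then show "C \<subseteq> fan n \<alpha>" "C \<subseteq> fan n \<beta>"
    unfolding C_def using a.dual_boundary_subset_fan b.dual_boundary_subset_fan
    by (intro hull_minimal; blast)+
qed

text \<open>A nonnegative point scaled to coordinate sum 1 lies in the same simplex of both
  boundaries; conversely, fan coordinates cannot be negative.\<close>

lemma common_facet_cone:
  assumes F: "F \<in> dual_facets n \<alpha> c p" "F \<in> dual_facets n \<beta> d q"
  shows "facet_point n F x \<in> C \<longleftrightarrow> (\<forall>S\<in>F. 0 \<le> x S)"
proof
  assume "facet_point n F x \<in> C"
  then show "\<forall>S\<in>F. 0 \<le> x S"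
    using a.fan_coordinates_nonneg[OF a.dual_facet_properties(1)[OF F(1)]] C_subset_fan by blast
next
  assume x: "\<forall>S\<in>F. 0 \<le> x S"
  let ?P = "dual_boundary n \<alpha> c p \<inter> dual_boundary n \<beta> d q"
  have P: "(\<Sum>S\<in>F. u S *\<^sub>R covector n S) \<in> ?P" if "\<forall>S\<in>F. 0 \<le> u S" "sum u F = 1" for u
    using a.covector_facet_boundary[OF a.dual_facet_properties(5)[OF F(1)] that]
      b.covector_facet_boundary[OF b.dual_facet_properties(5)[OF F(2)] that] by blast
  have scale: "r *\<^sub>R Y \<in> C" if "Y \<in> ?P" "0 \<le> r" for r Y
    unfolding C_def using that by (intro mem_cone cone_cone_hull hull_inc)
  note fin = a.dual_facet_properties(3)[OF F(1)]
  show "facet_point n F x \<in> C"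
  proof (cases "sum x F = 0")
    case True
    then have "\<forall>S\<in>F. x S = 0" using x fin by (simp add: sum_nonneg_eq_0_iff)
    then have "facet_point n F x = 0" by (simp add: facet_point_def)
    \<comment> \<open>The origin is in the cone as a multiple of some boundary point, and
      \<open>n \<ge> 4\<close> gives the facet a vertex.\<close>
    moreover have "F \<noteq> {}" using a.dual_facet_properties(4)[OF F(1)] a.n by auto
    then obtain S where "S \<in> F" by blast
    then have "(\<Sum>T\<in>F. of_bool (T = S) *\<^sub>R covector n T) \<in> ?P"
      using fin by (intro P) (auto simp: of_bool_def)
    then have "0 *\<^sub>R (\<Sum>T\<in>F. of_bool (T = S) *\<^sub>R covector n T) \<in> C" by (intro scale) auto
    ultimately show ?thesis by simp
  next
    case False
    have nn: "sum x F \<ge> 0" using x by (intro sum_nonneg) auto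
    have "facet_point n F x = sum x F *\<^sub>R (\<Sum>S\<in>F. (x S / sum x F) *\<^sub>R covector n S)"
      using False by (simp add: facet_point_def scaleR_sum_right)
    moreover have "(\<Sum>S\<in>F. (x S / sum x F) *\<^sub>R covector n S) \<in> ?P"
      using x False nn by (intro P) (auto simp flip: sum_divide_distrib)
    ultimately show ?thesis using scale nn by simp
  qed
qed

text \<open>Nonzero coordinates are positive because \<open>C\<close> lies in the fan of \<alpha>;
  positivity makes all of \<open>F\<close> consecutive for \<beta>, because \<open>C\<close> lies in
  the other fan as well. The size \<open>n - 3\<close> then makes \<open>F\<close> a facet.\<close>

lemma common_facet_I:
  assumes F: "F \<in> dual_facets n \<alpha> c p" and x: "facet_point n F x \<in> C" "\<forall>S\<in>F. x S \<noteq> 0"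
  shows "F \<in> dual_facets n \<beta> d q"
proof (rule b.dual_facet_I)
  note P = a.dual_facet_properties[OF F]
  have "x S > 0 \<and> card S \<ge> 2" if "S \<in> F" for S
    using a.fan_coordinates_nonneg[OF P(1) _ that, of x] x C_subset_fan that P(1) consecutive_card
    by (metis order_less_le subsetD)
  moreover have "F \<subseteq> Pow {1..n-1} - {{1..n-1}}" using P(1) a.consecutive_subset_Pow by blast
  ultimately show "F \<subseteq> consecutive n \<beta>"
    using b.positive_fan_support[OF _ P(2)] x(1) C_subset_fan(2) by blast
qed (use a.dual_facet_properties[OF F] in auto)

lemma common_facet_integral:
  assumes F: "F \<in> dual_facets n \<alpha> c p" "F \<in> dual_facets n \<beta> d q"
    and Z: "\<And>Y. Y \<in> C \<Longrightarrow> Y \<noteq> 0 \<Longrightarrow> Y Z > 0"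
  shows "(LINT x | Pi\<^sub>M F (\<lambda>_. lborel). indicator C (facet_point n F x) * exp (- 1 * facet_point n F x Z))
    = (\<Prod>S\<in>F. 1 / covector n S Z)"
proof -
  note P = a.dual_facet_properties[OF F(1)]
  \<comment> \<open>Each covector of \<open>F\<close> is itself a nonzero point of \<open>C\<close>,
    so the hypothesis on \<open>Z\<close> gives the positivity needed for convergence.\<close>
  have "covector n S Z > 0" if S: "S \<in> F" for S
  proof -
    have "facet_point n F (\<lambda>T. of_bool (T = S)) \<in> C"
      unfolding common_facet_cone[OF F] by simp
    moreover have "facet_point n F (\<lambda>T. of_bool (T = S)) = covector n S"
    proof
      show "facet_point n F (\<lambda>T. of_bool (T = S)) z = covector n S z" for z
        using S P(3) by (simp add: facet_point_apply of_bool_def if_distrib[of "\<lambda>t. t * _"] cong: if_cong)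
    qed
    moreover have "covector n S \<noteq> 0"
    proof
      assume 0: "covector n S = 0"
      obtain z where "covector n S z = 1" using a.consecutive_dual_basis[of S] S P(1) by (metis subsetD)
      then show False using 0 by simp
    qed
    ultimately show ?thesis using Z by simp
  qed
  moreover have "indicator C (facet_point n F x) = (of_bool (\<forall>S\<in>F. 0 \<le> x S) :: real)" for x
    by (simp add: indicator_def common_facet_cone[OF F])
  ultimately show ?thesis
    using exp_orthant_integral[OF P(3), of "\<lambda>S. covector n S Z"] by (simp add: facet_point_apply)
qed

lemma other_facet_integral:
  assumes F: "F \<in> dual_facets n \<alpha> c p" "F \<notin> dual_facets n \<beta> d q"
  shows "(LINT x | Pi\<^sub>M F (\<lambda>_. lborel). indicator C (facet_point n F x) * exp (- 1 * facet_point n F x Z)) = 0"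
proof (rule integral_eq_zero_AE)
  show "AE x in Pi\<^sub>M F (\<lambda>_. lborel). indicator C (facet_point n F x) * exp (- 1 * facet_point n F x Z) = 0"
    using AE_PiM_lborel_nonzero[OF a.dual_facet_properties(3)[OF F(1)]]
  proof eventually_elim
    case (elim x)
    then have "facet_point n F x \<notin> C" using common_facet_I F by blast
    then show ?case by simp
  qed
qed

end

theorem theorem4p1:
  fixes n :: nat and \<alpha> \<beta> :: "nat \<Rightarrow> nat"
    and c\<^sub>\<alpha> c\<^sub>\<beta> :: "nat \<Rightarrow> nat \<Rightarrow> real" and p\<^sub>\<alpha> p\<^sub>\<beta> Z :: kin
  defines "C \<equiv> cone hull (dual_boundary n \<alpha> c\<^sub>\<alpha> p\<^sub>\<alpha> \<inter> dual_boundary n \<beta> c\<^sub>\<beta> p\<^sub>\<beta>)"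
    and "\<F> \<equiv> dual_facets n \<alpha> c\<^sub>\<alpha> p\<^sub>\<alpha> \<union> dual_facets n \<beta> c\<^sub>\<beta> p\<^sub>\<beta>"
  assumes "n \<ge> 4"
    and "is_ordering n \<alpha>" and "is_ordering n \<beta>"
    and "assoc_constants n c\<^sub>\<alpha>" and "assoc_constants n c\<^sub>\<beta>"
    and "p\<^sub>\<alpha> \<in> assoc_interior n \<alpha> c\<^sub>\<alpha>" and "p\<^sub>\<beta> \<in> assoc_interior n \<beta> c\<^sub>\<beta>"
    and "Z \<in> kin_K n"
    and "\<And>W. W \<in> C \<Longrightarrow> W \<noteq> 0 \<Longrightarrow> W Z > 0"
  shows "amplitude n \<alpha> \<beta> Z = vol_integral n \<F> C Z 1"
proof -
  interpret ab: associahedron_pair n \<alpha> c\<^sub>\<alpha> p\<^sub>\<alpha> \<beta> c\<^sub>\<beta> p\<^sub>\<beta>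
    by unfold_locales (use assms in auto)
  interpret ba: associahedron_pair n \<beta> c\<^sub>\<beta> p\<^sub>\<beta> \<alpha> c\<^sub>\<alpha> p\<^sub>\<alpha> ..
  have C: "C = ab.C" "C = ba.C"
    by (simp_all add: C_def ab.C_def ba.C_def Int_commute)
  let ?A = "dual_facets n \<alpha> c\<^sub>\<alpha> p\<^sub>\<alpha>" and ?B = "dual_facets n \<beta> c\<^sub>\<beta> p\<^sub>\<beta>" and ?N = "{1..n-1}"
  let ?I = "\<lambda>F. LINT x | Pi\<^sub>M F (\<lambda>_. lborel).
      indicator C (facet_point n F x) * exp (- 1 * facet_point n F x Z)"
  have "vol_integral n \<F> C Z 1 = (\<Sum>F\<in>?A \<inter> ?B. ?I F)"
    unfolding vol_integral_def \<F>_def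
  proof (rule sum.mono_neutral_right)
    show "\<forall>F\<in>?A \<union> ?B - ?A \<inter> ?B. ?I F = 0"
    proof
      fix F assume "F \<in> ?A \<union> ?B - ?A \<inter> ?B"
      then consider "F \<in> ?A" "F \<notin> ?B" | "F \<in> ?B" "F \<notin> ?A" by blast
      then show "?I F = 0"
        using ab.other_facet_integral[of F Z] ba.other_facet_integral[of F Z] C by cases simp_all
    qed
  qed (use ab.a.finite_dual_facets ab.b.finite_dual_facets in auto)
  also have "\<dots> = (\<Sum>F\<in>?A \<inter> ?B. \<Prod>S\<in>F. 1 / covector n S Z)"
    using ab.common_facet_integral[of _ Z] assms(11) C(1) by (intro sum.cong) auto
  finally have vol: "vol_integral n \<F> C Z 1 = (\<Sum>F\<in>?A \<inter> ?B. \<Prod>S\<in>F. 1 / covector n S Z)" .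
  let ?G = "{g \<in> trivalent_graphs n. planar n \<alpha> g \<and> planar n \<beta> g}"
  have lab: "labelled_by ?N g" if "g \<in> ?G" for g
    using that by (simp add: trivalent_graphs_def)
  have full: "?N \<in> clades g" if "g \<in> ?G" for g
    using ab.a.full_mem_clades[of g] that by (simp add: planar_def)
  \<comment> \<open>A common facet comes from one tree for each ordering; after
    \<open>{1..n-1}\<close> is put back, equal clades make these the same tree, which is planar for
    both.\<close>
  have bij: "bij_betw (\<lambda>g. clades g - {?N}) ?G (?A \<inter> ?B)"
    unfolding bij_betw_def
  proof
    show "inj_on (\<lambda>g. clades g - {?N}) ?G"
    proof (rule inj_onI)
      fix g h assume gh: "g \<in> ?G" "h \<in> ?G" "clades g - {?N} = clades h - {?N}"
      then have "clades g = clades h" using full[OF gh(1)] full[OF gh(2)] by (metis insert_Diff)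
      then show "g = h" using clades_injective lab gh(1,2) by blast
    qed
    show "(\<lambda>g. clades g - {?N}) ` ?G = ?A \<inter> ?B"
    proof (intro equalityI subsetI)
      fix F assume "F \<in> (\<lambda>g. clades g - {?N}) ` ?G"
      then show "F \<in> ?A \<inter> ?B"
        unfolding ab.a.dual_facets_eq ab.b.dual_facets_eq planar_def by blast
    next
      fix F assume "F \<in> ?A \<inter> ?B"
      then have F: "F \<in> ?A" "F \<in> ?B" by auto
      obtain g where g: "drawn_with g (map \<alpha> [1..<n])" "F = clades g - {?N}"
        using F(1) unfolding ab.a.dual_facets_eq by blast
      obtain h where h: "drawn_with h (map \<beta> [1..<n])" "F = clades h - {?N}"
        using F(2) unfolding ab.b.dual_facets_eq by blast
      have "clades g = clades h"
        using ab.a.full_mem_clades[OF g(1)] ab.b.full_mem_clades[OF h(1)] g(2) h(2) by (metis insert_Diff)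
      then have "g = h"
        using clades_injective ab.a.drawn_labelled[OF g(1)] ab.b.drawn_labelled[OF h(1)] by blast
      then have "g \<in> ?G"
        using g h ab.a.drawn_labelled[OF g(1)] by (simp add: trivalent_graphs_def planar_def)
      then show "F \<in> (\<lambda>g. clades g - {?N}) ` ?G" using g(2) by blast
    qed
  qed
  have "amplitude n \<alpha> \<beta> Z = (\<Sum>g\<in>?G. \<Prod>S\<in>clades g - {?N}. 1 / covector n S Z)"
    unfolding amplitude_def
  proof (intro sum.cong refl)
    fix g assume g: "g \<in> ?G"
    have "card ?N \<ge> 2" using assms(3) by simp
    note E = internal_edges_drawn[OF lab[OF g] this]
    have "1 / - mandelstam S Z = 1 / covector n S Z" if "S \<in> clades g" for S
    proof -
      have "finite S" using clades_subset[OF lab[OF g] that] by (rule finite_subset) simp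
      then show ?thesis using covector_mandelstam[OF assms(10)] by simp
    qed
    then have "(\<Prod>S\<in>clades g - {?N}. 1 / covector n S Z) = (\<Prod>S\<in>clades g - {?N}. 1 / - mandelstam S Z)"
      by (intro prod.cong) auto
    also have "\<dots> = (\<Prod>t\<in>internal_edges g. 1 / - mandelstam (leaf_labels t) Z)"
      unfolding E(2)[symmetric] by (subst prod.reindex[OF E(1)]) (simp add: o_def)
    finally show "(\<Prod>t\<in>internal_edges g. 1 / - mandelstam (leaf_labels t) Z)
      = (\<Prod>S\<in>clades g - {?N}. 1 / covector n S Z)" ..
  qed
  also have "\<dots> = (\<Sum>F\<in>?A \<inter> ?B. \<Prod>S\<in>F. 1 / covector n S Z)"
    by (rule sum.reindex_bij_betw[OF bij])
  finally show ?thesis using vol by simp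
qed

end
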